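(* Let $(\mathcal B;B_1,B_2)$ be a boundary triplet for the operator $A_0^*$ on a Hilbert space $X$, let $\mathcal K$ be a Hilbert space, and let $W_B=\begin{bmatrix}W_1&W_2\end{bmatrix}$ be a bounded everywhere-defined linear operator from $\mathcal B^2$ into $\mathcal K$. Let $A$ be the restriction of $A_0^*$ to $$\mathrm{dom}(A)=\{x\in\mathrm{dom}(A_0^* )\mid W_1B_1x+W_2B_2x=0\}.$$ Assume that $\mathrm{ran}(W_1-W_2)\subset\mathrm{ran}(W_1+W_2)$. Then the following conditions are equivalent: 1. The operator $A$ generates a contraction semigroup on $X$. 2. The operator $A$ is dissipative. 3. The operator $W_1+W_2$ is injective and the operator inequality $W_1W_2^*+W_2W_1^*\ge0$ holds in $\mathcal K$.
   Context: Hilbert spaces are complex. Semigroups are strongly continuous. An operator $A$ on $X$ is dissipative if $\mathrm{Re}\langle x,Ax\rangle_X\le0$ for all $x\in\mathrm{dom}(A)$; it is skew-symmetric if $\mathrm{Re}\langle x,Ax\rangle_X=0$ for all $x\in\mathrm{dom}(A)$. Elements of $\mathcal B^2$ are written as columns, and $\begin{bmatrix}W_1&W_2\end{bmatrix}\begin{bmatrix}f \\ e\end{bmatrix}=W_1f+W_2e$. Boundary triplet: let $A_0$ be a densely defined, skew-symmetric, closed linear operator on a Hilbert space $X$. A boundary triplet for $A_0^*$ is a triple $(\mathcal B;B_1,B_2)$ consisting of a Hilbert space $\mathcal B$ and two bounded linear operators $B_1,B_2:\mathrm{dom}(A_0^* )\to\mathcal B$ (where $\mathrm{dom}(A_0^*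 )$ carries the graph norm) such that $\begin{bmatrix}B_1 \\ B_2\end{bmatrix}\mathrm{dom}(A_0^* )=\mathcal B^2$ and, for all $x,\tilde x\in\mathrm{dom}(A_0^* )$, $$\langle A_0^*x,\tilde x\rangle_X+\langle x,A_0^*\tilde x\rangle_X=\langle B_1x,B_2\tilde x\rangle_{\mathcal B}+\langle B_2x,B_1\tilde x\rangle_{\mathcal B}.$$ *)

theory Defs
  imports "HOL-Analysis.Analysis"
begin

text \<open>
  Complex inner product spaces, on top of the real normed spaces of the library. The inner product
  is linear in its first and antilinear in its second argument; the statements made with it below
  (dissipativity, adjoints, Green's identity, positivity) mean the same under the opposite
  convention.
\<close>

class complex_inner = real_normed_vector +
  fixes scaleC :: "complex \<Rightarrow> 'a \<Rightarrow> 'a"  (infixr \<open>*\<^sub>C\<close> 75)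
    and cinner :: "'a \<Rightarrow> 'a \<Rightarrow> complex"
  assumes scaleC_add_right: "a *\<^sub>C (x + y) = a *\<^sub>C x + a *\<^sub>C y"
    and scaleC_add_left: "(a + b) *\<^sub>C x = a *\<^sub>C x + b *\<^sub>C x"
    and scaleC_scaleC: "a *\<^sub>C (b *\<^sub>C x) = (a * b) *\<^sub>C x"
    and scaleC_of_real: "complex_of_real r *\<^sub>C x = r *\<^sub>R x"
    and cinner_commute: "cinner x y = cnj (cinner y x)"
    and cinner_add_left: "cinner (x + y) z = cinner x z + cinner y z"
    and cinner_scaleC_left: "cinner (a *\<^sub>C x) y = a * cinner x y"
    and cinner_self: "cinner x x = complex_of_real ((norm x)\<^sup>2)"

class complex_hilbert = complex_inner + banach

instantiation complex :: complex_hilbert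
begin

definition scaleC_complex :: "complex \<Rightarrow> complex \<Rightarrow> complex" where
  "scaleC_complex a x = a * x"

definition cinner_complex :: "complex \<Rightarrow> complex \<Rightarrow> complex" where
  "cinner_complex x y = x * cnj y"

instance
proof
  fix x :: complex
  show "cinner x x = complex_of_real ((norm x)\<^sup>2)"
    unfolding cinner_complex_def by (rule complex_norm_square[symmetric])
qed (simp_all add: scaleC_complex_def cinner_complex_def distrib_left distrib_right
      scaleR_conv_of_real)

end

text \<open>The Hilbert space of columns; its norm is the library's norm on the product.\<close>

instantiation prod :: (complex_inner, complex_inner) complex_inner
begin

definition scaleC_prod :: "complex \<Rightarrow> 'a \<times> 'b \<Rightarrow> 'a \<times> 'b" where
  "scaleC_prod a p = (a *\<^sub>C fst p, a *\<^sub>C snd p)"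

definition cinner_prod :: "'a \<times> 'b \<Rightarrow> 'a \<times> 'b \<Rightarrow> complex" where
  "cinner_prod p q = cinner (fst p) (fst q) + cinner (snd p) (snd q)"

instance
proof
  fix p q :: "'a \<times> 'b"
  show "cinner p q = cnj (cinner q p)"
    using cinner_commute[of "fst p" "fst q"] cinner_commute[of "snd p" "snd q"]
    by (simp add: cinner_prod_def)
qed (auto simp add: scaleC_prod_def cinner_prod_def scaleC_add_right scaleC_add_left scaleC_scaleC
      scaleC_of_real cinner_add_left cinner_scaleC_left cinner_self norm_prod_def distrib_left
      scaleR_prod_def)

end

instance prod :: (complex_hilbert, complex_hilbert) complex_hilbert ..

definition bounded_clinear :: "('a::complex_inner \<Rightarrow> 'b::complex_inner) \<Rightarrow> bool" where
  "bounded_clinear f \<longleftrightarrow> bounded_linear f \<and> (\<forall>c x. f (c *\<^sub>C x) = c *\<^sub>C f x)"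

definition cadjoint :: "('a::complex_inner \<Rightarrow> 'b::complex_inner) \<Rightarrow> 'b \<Rightarrow> 'a" where
  "cadjoint W y = (THE z. \<forall>x. cinner (W x) y = cinner x z)"

definition nonneg_operator :: "('a::complex_inner \<Rightarrow> 'a) \<Rightarrow> bool" where
  "nonneg_operator S \<longleftrightarrow> (\<forall>x. cinner x (S x) \<in> \<real>\<^sub>\<ge>\<^sub>0)"

text \<open>
  A possibly unbounded operator is a partial map, so that equality of operators includes equality of
  their domains. Its domain is \<^term>\<open>dom A\<close>, its value at a point \<open>x\<close> of the domain is
  \<^term>\<open>the (A x)\<close>, its graph is \<^term>\<open>Map.graph A\<close>, and restriction is \<^const>\<open>restrict_map\<close>.
\<close>

definition linear_operator :: "('a::complex_inner \<rightharpoonup> 'b::complex_inner) \<Rightarrow> bool" where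
  "linear_operator A \<longleftrightarrow>
     0 \<in> dom A \<and>
     (\<forall>x\<in>dom A. \<forall>y\<in>dom A. x + y \<in> dom A \<and> the (A (x + y)) = the (A x) + the (A y)) \<and>
     (\<forall>c. \<forall>x\<in>dom A. c *\<^sub>C x \<in> dom A \<and> the (A (c *\<^sub>C x)) = c *\<^sub>C the (A x))"

definition densely_defined :: "('a::complex_inner \<rightharpoonup> 'b::complex_inner) \<Rightarrow> bool" where
  "densely_defined A \<longleftrightarrow> closure (dom A) = UNIV"

definition closed_operator :: "('a::complex_inner \<rightharpoonup> 'b::complex_inner) \<Rightarrow> bool" where
  "closed_operator A \<longleftrightarrow> closed (Map.graph A)"

definition dissipative :: "('a::complex_inner \<rightharpoonup> 'a) \<Rightarrow> bool" where
  "dissipative A \<longleftrightarrow> (\<forall>x\<in>dom A. Re (cinner x (the (A x))) \<le> 0)"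

definition skew_symmetric :: "('a::complex_inner \<rightharpoonup> 'a) \<Rightarrow> bool" where
  "skew_symmetric A \<longleftrightarrow> (\<forall>x\<in>dom A. Re (cinner x (the (A x))) = 0)"

text \<open>Meaningful for densely defined operators only, where the value is uniquely determined.\<close>

definition adjoint_operator ::
    "('a::complex_inner \<rightharpoonup> 'b::complex_inner) \<Rightarrow> ('b \<rightharpoonup> 'a)" where
  "adjoint_operator A = (\<lambda>y.
     if \<exists>z. \<forall>x\<in>dom A. cinner (the (A x)) y = cinner x z
     then Some (THE z. \<forall>x\<in>dom A. cinner (the (A x)) y = cinner x z)
     else None)"

definition graph_norm :: "('a::complex_inner \<rightharpoonup> 'b::complex_inner) \<Rightarrow> 'a \<Rightarrow> real" where
  "graph_norm A x = sqrt ((norm x)\<^sup>2 + (norm (the (A x)))\<^sup>2)"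

text \<open>
  Bounded linear operators from \<^term>\<open>dom A\<close>, with the graph norm, to another space. They are total
  functions here, whose values outside \<^term>\<open>dom A\<close> are irrelevant.
\<close>

definition graph_bounded_clinear ::
    "('a::complex_inner \<rightharpoonup> 'b::complex_inner) \<Rightarrow> ('a \<Rightarrow> 'c::complex_inner) \<Rightarrow> bool" where
  "graph_bounded_clinear A B \<longleftrightarrow>
     (\<forall>x\<in>dom A. \<forall>y\<in>dom A. B (x + y) = B x + B y) \<and>
     (\<forall>c. \<forall>x\<in>dom A. B (c *\<^sub>C x) = c *\<^sub>C B x) \<and>
     (\<exists>M. \<forall>x\<in>dom A. norm (B x) \<le> M * graph_norm A x)"

text \<open>
  \<open>(B; B\<^sub>1, B\<^sub>2)\<close> is a boundary triplet for the adjoint of \<open>A\<^sub>0\<close>; the space \<open>B\<close> is the type \<open>'b\<close>.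
\<close>

definition boundary_triplet ::
    "('x::complex_hilbert \<rightharpoonup> 'x) \<Rightarrow> ('x \<Rightarrow> 'b::complex_hilbert) \<Rightarrow> ('x \<Rightarrow> 'b) \<Rightarrow> bool" where
  "boundary_triplet A\<^sub>0 B\<^sub>1 B\<^sub>2 \<longleftrightarrow>
     linear_operator A\<^sub>0 \<and> densely_defined A\<^sub>0 \<and> skew_symmetric A\<^sub>0 \<and> closed_operator A\<^sub>0 \<and>
     graph_bounded_clinear (adjoint_operator A\<^sub>0) B\<^sub>1 \<and>
     graph_bounded_clinear (adjoint_operator A\<^sub>0) B\<^sub>2 \<and>
     (\<lambda>x. (B\<^sub>1 x, B\<^sub>2 x)) ` dom (adjoint_operator A\<^sub>0) = UNIV \<and>
     (\<forall>x\<in>dom (adjoint_operator A\<^sub>0). \<forall>y\<in>dom (adjoint_operator A\<^sub>0).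
        cinner (the (adjoint_operator A\<^sub>0 x)) y + cinner x (the (adjoint_operator A\<^sub>0 y)) =
        cinner (B\<^sub>1 x) (B\<^sub>2 y) + cinner (B\<^sub>2 x) (B\<^sub>1 y))"

text \<open>Only the values of \<open>T\<close> at times \<open>t \<ge> 0\<close> matter.\<close>

definition strongly_continuous_semigroup :: "(real \<Rightarrow> 'a::complex_inner \<Rightarrow> 'a) \<Rightarrow> bool" where
  "strongly_continuous_semigroup T \<longleftrightarrow>
     (\<forall>t\<ge>0. bounded_clinear (T t)) \<and>
     T 0 = id \<and>
     (\<forall>s\<ge>0. \<forall>t\<ge>0. T (s + t) = T s \<circ> T t) \<and>
     (\<forall>x. ((\<lambda>t. T t x) \<longlongrightarrow> x) (at_right 0))"

definition contraction_semigroup :: "(real \<Rightarrow> 'a::complex_inner \<Rightarrow> 'a) \<Rightarrow> bool" where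
  "contraction_semigroup T \<longleftrightarrow>
     strongly_continuous_semigroup T \<and> (\<forall>t\<ge>0. \<forall>x. norm (T t x) \<le> norm x)"

definition generator :: "(real \<Rightarrow> 'a::complex_inner \<Rightarrow> 'a) \<Rightarrow> ('a \<rightharpoonup> 'a)" where
  "generator T = (\<lambda>x.
     if \<exists>y. ((\<lambda>t. (T t x - x) /\<^sub>R t) \<longlongrightarrow> y) (at_right 0)
     then Some (Lim (at_right 0) (\<lambda>t. (T t x - x) /\<^sub>R t))
     else None)"

definition generates_contraction_semigroup :: "('a::complex_inner \<rightharpoonup> 'a) \<Rightarrow> bool" where
  "generates_contraction_semigroup A \<longleftrightarrow> (\<exists>T. contraction_semigroup T \<and> generator T = A)"

end

theory Submission
  imports Defs
begin

text \<open>
  Write \<open>p = B\<^sub>1 x + B\<^sub>2 x\<close>, \<open>q = B\<^sub>1 x - B\<^sub>2 x\<close> and \<open>S = W\<^sub>1 + W\<^sub>2\<close>, \<open>D = W\<^sub>1 - W\<^sub>2\<close>. In these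
  coordinates Green's identity reads \<open>4 Re \<langle>x, A\<^sub>0\<^sup>* x\<rangle> = \<parallel>p\<parallel>\<^sup>2 - \<parallel>q\<parallel>\<^sup>2\<close>, the boundary condition is
  \<open>S p + D q = 0\<close>, and \<open>W\<^sub>1 W\<^sub>2\<^sup>* + W\<^sub>2 W\<^sub>1\<^sup>*\<close> is half of \<open>S S\<^sup>* - D D\<^sup>*\<close>. Since all pairs \<open>(p, q)\<close> are
  boundary values, \<open>A\<close> is dissipative iff \<open>S p + D q = 0\<close> implies \<open>\<parallel>p\<parallel> \<le> \<parallel>q\<parallel>\<close>. With \<open>q = 0\<close> this
  makes \<open>S\<close> injective; the inclusion of the ranges then exhibits the relation as the graph of a
  contraction \<open>q \<mapsto> p\<close> defined everywhere, and passing to adjoints turns this into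
  \<open>\<parallel>D\<^sup>* k\<parallel> \<le> \<parallel>S\<^sup>* k\<parallel>\<close>, that is, into positivity of \<open>S S\<^sup>* - D D\<^sup>*\<close>. This gives the equivalence of
  dissipativity with the condition on \<open>W\<^sub>1\<close> and \<open>W\<^sub>2\<close> (\<open>dissipative_iff\<close>, \<open>contractive_relation_iff\<close>,
  \<open>nonneg_operator_iff\<close>).

  A generator of a contraction semigroup is dissipative because \<open>Re \<langle>x, T t x - x\<rangle> \<le> 0\<close>. Conversely,
  \<open>A\<close> is closed and densely defined, so if it is dissipative, then \<open>1 - h A\<close> has closed range for
  \<open>h > 0\<close>. A vector \<open>y\<close> orthogonal to that range lies in the domain of \<open>A\<^sub>0\<^sup>*\<close> with
  \<open>h A\<^sub>0\<^sup>* y = - y\<close>, and its boundary values satisfy the adjoint boundary condition, which forces \<open>Re \<langle>y, A\<^sub>0\<^sup>* y\<rangle> \<ge> 0\<close> and hence \<open>y = 0\<close>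
  (\<open>m_dissipative_A\<close>). Thus \<open>1 - h A\<close> is onto for all \<open>h > 0\<close>.

  The semigroup is then the limit of the implicit Euler scheme \<open>(1 - t/n A)\<^sup>-\<^sup>n\<close> along \<open>n = 2\<^sup>k\<close>.
  Convergence and the semigroup law both come from one estimate for the contractions
  \<open>J\<^sub>h = (1 - h A)\<^sup>-\<^sup>1\<close>, namely \<open>\<parallel>J\<^sub>a J\<^sub>b x - J\<^bsub>a+b\<^esub> x\<parallel> \<le> a b \<parallel>A\<^sup>2 x\<parallel>\<close> (\<open>resolvent_add_le\<close>), and from
  \<open>\<parallel>U\<^sup>n x - V\<^sup>n x\<parallel> \<le> n \<parallel>U x - V x\<parallel>\<close> for commuting contractions (\<open>norm_funpow_diff_le\<close>): \<open>2\<^sup>k\<close> steps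
  with an error of order \<open>4\<^sup>-\<^sup>k\<close> each have a total error of order \<open>2\<^sup>-\<^sup>k\<close>.
\<close>


section \<open>Complex inner product spaces\<close>

lemma scaleC_zero_left [simp]: "0 *\<^sub>C (x::'a::complex_inner) = 0"
  using scaleC_of_real[of 0 x] by simp

lemma scaleC_one [simp]: "1 *\<^sub>C (x::'a::complex_inner) = x"
  using scaleC_of_real[of 1 x] by simp

lemma scaleC_zero_right [simp]: "a *\<^sub>C (0::'a::complex_inner) = 0"
  using scaleC_add_right[of a 0 0] by simp

lemma scaleC_minus_left: "(- a) *\<^sub>C (x::'a::complex_inner) = - (a *\<^sub>C x)"
  using scaleC_add_left[of a "- a" x]
  by (simp add: eq_neg_iff_add_eq_0 add.commute)

lemma scaleC_minus_right: "a *\<^sub>C (- x::'a::complex_inner) = - (a *\<^sub>C x)"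
  using scaleC_add_right[of a x "- x"] by (simp add: eq_neg_iff_add_eq_0 add.commute)

lemma scaleC_diff_right: "a *\<^sub>C (x - y::'a::complex_inner) = a *\<^sub>C x - a *\<^sub>C y"
  using scaleC_add_right[of a x "- y"] by (simp add: scaleC_minus_right)

lemma scaleR_scaleC_commute: "a *\<^sub>C (r *\<^sub>R (x::'a::complex_inner)) = r *\<^sub>R (a *\<^sub>C x)"
  by (metis mult.commute scaleC_of_real scaleC_scaleC)

lemma cinner_add_right: "cinner x (y + z) = cinner x y + cinner x (z::'a::complex_inner)"
  by (metis cinner_add_left cinner_commute complex_cnj_add)

lemma cinner_scaleC_right: "cinner x (a *\<^sub>C y) = cnj a * cinner x (y::'a::complex_inner)"
  by (metis cinner_scaleC_left cinner_commute complex_cnj_mult)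

lemma cinner_scaleR_left: "cinner (r *\<^sub>R x) (y::'a::complex_inner) = r *\<^sub>R cinner x y"
  by (metis cinner_scaleC_left scaleC_of_real scaleR_conv_of_real)

lemma cinner_scaleR_right: "cinner x (r *\<^sub>R (y::'a::complex_inner)) = r *\<^sub>R cinner x y"
  by (metis cinner_scaleC_right complex_cnj_complex_of_real scaleC_of_real scaleR_conv_of_real)

lemma cinner_zero_left [simp]: "cinner 0 (x::'a::complex_inner) = 0"
  using cinner_add_left[of 0 0 x] by simp

lemma cinner_zero_right [simp]: "cinner (x::'a::complex_inner) 0 = 0"
  using cinner_add_right[of x 0 0] by simp

lemma cinner_minus_left: "cinner (- x) (y::'a::complex_inner) = - cinner x y"
  using cinner_scaleR_left[of "- 1" x y] by simp

lemma cinner_minus_right: "cinner x (- y::'a::complex_inner) = - cinner x y"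
  using cinner_scaleR_right[of x "- 1" y] by simp

lemma cinner_diff_left: "cinner (x - y) (z::'a::complex_inner) = cinner x z - cinner y z"
  using cinner_add_left[of x "- y" z] by (simp add: cinner_minus_left)

lemma cinner_diff_right: "cinner x (y - z::'a::complex_inner) = cinner x y - cinner x z"
  using cinner_add_right[of x y "- z"] by (simp add: cinner_minus_right)

lemma Re_cinner_commute: "Re (cinner x y) = Re (cinner y (x::'a::complex_inner))"
  by (subst cinner_commute) simp

lemma Re_cinner_self: "Re (cinner x (x::'a::complex_inner)) = (norm x)\<^sup>2"
  by (simp add: cinner_self)

lemma norm_add_sq: "(norm (x + y))\<^sup>2 = (norm x)\<^sup>2 + 2 * Re (cinner x y) + (norm (y::'a::complex_inner))\<^sup>2"
proof -
  have "(norm (x + y))\<^sup>2 = Re (cinner (x + y) (x + y))"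
    by (simp add: Re_cinner_self)
  also have "\<dots> = (norm x)\<^sup>2 + Re (cinner x y) + Re (cinner y x) + (norm y)\<^sup>2"
    by (simp add: cinner_add_left cinner_add_right Re_cinner_self)
  finally show ?thesis using Re_cinner_commute[of y x] by simp
qed

lemma norm_diff_sq: "(norm (x - y))\<^sup>2 = (norm x)\<^sup>2 - 2 * Re (cinner x y) + (norm (y::'a::complex_inner))\<^sup>2"
  using norm_add_sq[of x "- y"] by (simp add: cinner_minus_right)

lemma norm_scaleC: "norm (a *\<^sub>C (x::'a::complex_inner)) = cmod a * norm x"
proof -
  have "complex_of_real ((norm (a *\<^sub>C x))\<^sup>2) = (a * cnj a) * cinner x x"
    by (simp only: cinner_self[symmetric]) (simp add: cinner_scaleC_left cinner_scaleC_right)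
  also have "\<dots> = complex_of_real ((cmod a * norm x)\<^sup>2)"
    by (simp add: cinner_self complex_norm_square power_mult_distrib del: of_real_power)
  finally have "(norm (a *\<^sub>C x))\<^sup>2 = (cmod a * norm x)\<^sup>2"
    by (simp only: of_real_eq_iff)
  then show ?thesis by (simp add: power2_eq_iff_nonneg)
qed

text \<open>
  The triangle inequality, which is part of the class, already contains the bound on the real part;
  rotating one argument turns the real part into the modulus.
\<close>

lemma cinner_Cauchy_Schwarz: "cmod (cinner x y) \<le> norm x * norm (y::'a::complex_inner)"
proof -
  have Re_le: "Re (cinner u y) \<le> norm u * norm y" for u :: 'a
  proof -
    have "(norm (u + y))\<^sup>2 \<le> (norm u + norm y)\<^sup>2"
      by (intro power_mono norm_triangle_ineq norm_ge_zero)
    then show ?thesis by (simp add: norm_add_sq power2_sum)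
  qed
  show ?thesis
  proof (cases "cinner x y = 0")
    case False
    define c where "c = cnj (cinner x y) / cmod (cinner x y)"
    have c: "cmod c = 1" using False by (simp add: c_def norm_divide)
    have "c * cinner x y = complex_of_real (cmod (cinner x y))"
      using False by (simp add: c_def complex_norm_square[symmetric] mult.commute
          power2_eq_square field_simps del: of_real_power)
    then have "cmod (cinner x y) = Re (cinner (c *\<^sub>C x) y)"
      by (simp add: cinner_scaleC_left)
    also have "\<dots> \<le> norm (c *\<^sub>C x) * norm y" by (rule Re_le)
    finally show ?thesis using c by (simp add: norm_scaleC)
  qed simp
qed

lemma Re_cinner_le: "Re (cinner x y) \<le> norm x * norm (y::'a::complex_inner)"
  using cinner_Cauchy_Schwarz[of x y] complex_Re_le_cmod[of "cinner x y"] by linarith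

lemma bounded_bilinear_cinner:
  "bounded_bilinear (cinner :: 'a::complex_inner \<Rightarrow> 'a \<Rightarrow> complex)"
  by (rule bounded_bilinear.intro)
    (auto simp: cinner_add_left cinner_add_right cinner_scaleR_left cinner_scaleR_right
      intro!: exI[of _ 1] cinner_Cauchy_Schwarz)

lemmas tendsto_cinner [tendsto_intros] = bounded_bilinear.tendsto[OF bounded_bilinear_cinner]

lemma bounded_clinear_simps:
  assumes "bounded_clinear W"
  shows "W (x + y) = W x + W y" "W (x - y) = W x - W y" "W (- x) = - W x" "W 0 = 0"
    "W (r *\<^sub>R x) = r *\<^sub>R W x" "W (c *\<^sub>C x) = c *\<^sub>C W x"
proof -
  interpret bounded_linear W using assms by (simp add: bounded_clinear_def)
  show "W (x + y) = W x + W y" "W (x - y) = W x - W y" "W (- x) = - W x" "W 0 = 0"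
    "W (r *\<^sub>R x) = r *\<^sub>R W x"
    by (rule add diff neg zero scale)+
  show "W (c *\<^sub>C x) = c *\<^sub>C W x" using assms by (simp add: bounded_clinear_def)
qed


section \<open>Orthogonal projection, Riesz representation and adjoints\<close>

definition csubspace :: "'a::complex_inner set \<Rightarrow> bool" where
  "csubspace M \<longleftrightarrow> 0 \<in> M \<and> (\<forall>x\<in>M. \<forall>y\<in>M. x + y \<in> M) \<and> (\<forall>c. \<forall>x\<in>M. c *\<^sub>C x \<in> M)"

text \<open>
  A sequence in \<open>M\<close> that minimizes the distance to \<open>z\<close> is Cauchy by the parallelogram law, and its
  limit \<open>m\<close> attains the distance. Moving \<open>m\<close> along \<open>x \<in> M\<close> cannot bring it closer to \<open>z\<close>, which to
  first order says that \<open>z - m\<close> is orthogonal to \<open>x\<close>.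
\<close>

lemma orthogonal_projection_exists:
  fixes z :: "'a::complex_hilbert"
  assumes M: "csubspace M"
  shows "\<exists>m\<in>closure M. \<forall>x\<in>M. cinner x (z - m) = 0"
proof -
  define d where "d = infdist z M"
  have M0: "M \<noteq> {}" and M_add: "\<And>x y. x \<in> M \<Longrightarrow> y \<in> M \<Longrightarrow> x + y \<in> M"
    and M_scale: "\<And>c x. x \<in> M \<Longrightarrow> c *\<^sub>C x \<in> M"
    using M by (auto simp: csubspace_def)
  have d_le: "d \<le> norm (z - x)" if "x \<in> M" for x
    using infdist_le[OF that, of z] by (simp add: d_def dist_norm)
  have d0: "0 \<le> d" by (simp add: d_def infdist_nonneg)
  have "\<exists>x\<in>M. norm (z - x) < d + 1 / real (Suc n)" for n
  proof (rule ccontr)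
    assume "\<not> ?thesis"
    then have "d + 1 / real (Suc n) \<le> (INF x\<in>M. dist z x)"
      using M0 by (intro cINF_greatest) (auto simp: dist_norm not_less)
    then show False using M0 by (simp add: d_def infdist_def)
  qed
  then obtain s where s: "\<And>n. s n \<in> M" "\<And>n. norm (z - s n) < d + 1 / real (Suc n)"
    by metis
  have near: "(norm (s i - s j))\<^sup>2 \<le> 4 * ((d + 1 / real (Suc N))\<^sup>2 - d\<^sup>2)" if "N \<le> i" "N \<le> j" for i j N
  proof -
    have sq: "(norm (z - s i))\<^sup>2 \<le> (d + 1 / real (Suc N))\<^sup>2" if "N \<le> i" for i
    proof -
      have "1 / real (Suc i) \<le> 1 / real (Suc N)" using that by (simp add: frac_le)
      then show ?thesis using s(2)[of i] by (intro power_mono) auto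
    qed
    \<comment> \<open>the midpoint lies in \<open>M\<close>, so it is at distance at least \<open>d\<close> from \<open>z\<close>\<close>
    define u where "u = (1/2::complex) *\<^sub>C (s i + s j)"
    have "u \<in> M" unfolding u_def by (intro M_scale M_add s)
    have u2: "u + u = s i + s j"
      unfolding u_def by (simp flip: scaleC_add_left)
    have "(norm ((z - s i) + (z - s j)))\<^sup>2 + (norm ((z - s i) - (z - s j)))\<^sup>2
        = 2 * (norm (z - s i))\<^sup>2 + 2 * (norm (z - s j))\<^sup>2"
      unfolding norm_add_sq norm_diff_sq[of "z - s i"] by simp
    moreover have "(z - s i) + (z - s j) = 2 *\<^sub>R (z - u)"
      using u2 by (simp add: scaleR_2 algebra_simps)
    moreover have "norm ((z - s i) - (z - s j)) = norm (s i - s j)"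
      by (simp add: norm_minus_commute)
    moreover have "d\<^sup>2 \<le> (norm (z - u))\<^sup>2"
      using d_le[OF \<open>u \<in> M\<close>] d0 by (intro power_mono)
    ultimately show ?thesis using sq[OF that(1)] sq[OF that(2)]
      by (simp add: power_mult_distrib)
  qed
  have "Cauchy s"
  proof (rule metric_CauchyI)
    fix e :: real assume e: "0 < e"
    have "(\<lambda>N. 4 * ((d + 1 / real (Suc N))\<^sup>2 - d\<^sup>2)) \<longlonglongrightarrow> 4 * ((d + 0)\<^sup>2 - d\<^sup>2)"
      by (intro tendsto_intros LIMSEQ_Suc[OF lim_const_over_n])
    then have "\<forall>\<^sub>F N in sequentially. 4 * ((d + 1 / real (Suc N))\<^sup>2 - d\<^sup>2) < e\<^sup>2"
      using e by (intro order_tendstoD) auto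
    then obtain N where N: "4 * ((d + 1 / real (Suc N))\<^sup>2 - d\<^sup>2) < e\<^sup>2"
      by (auto simp: eventually_sequentially)
    have "dist (s i) (s j) < e" if "i \<ge> N" "j \<ge> N" for i j
      using near[OF that] N e by (auto simp: dist_norm intro: power2_less_imp_less)
    then show "\<exists>N. \<forall>i\<ge>N. \<forall>j\<ge>N. dist (s i) (s j) < e" by blast
  qed
  then obtain m where m: "s \<longlonglongrightarrow> m" using Cauchy_convergent_iff convergent_def by blast
  have "m \<in> closure M" using m s(1) closure_sequential by blast
  moreover have "cinner x (z - m) = 0" if x: "x \<in> M" for x
  proof (rule ccontr)
    assume nz: "cinner x (z - m) \<noteq> 0"
    define y where "y = z - m"
    define p where "p = (cmod (cinner y x))\<^sup>2"
    have p: "p > 0" using nz cinner_commute[of x "z - m"] by (simp add: p_def y_def)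
    have "(\<lambda>n. norm (z - s n)) \<longlonglongrightarrow> norm y"
      unfolding y_def by (intro tendsto_intros m)
    moreover have "(\<lambda>n. d + 1 / real (Suc n)) \<longlonglongrightarrow> d + 0"
      by (intro tendsto_intros LIMSEQ_Suc[OF lim_const_over_n])
    ultimately have "norm y \<le> d"
      using s(2) by (intro LIMSEQ_le[of "\<lambda>n. norm (z - s n)" _ "\<lambda>n. d + 1 / real (Suc n)"])
        (auto intro: less_imp_le)
    \<comment> \<open>The phase of \<open>c\<close> makes \<open>\<langle>y, c x\<rangle>\<close> positive; \<open>t\<close> is so small that the linear gain exceeds the
      quadratic loss.\<close>
    define t where "t = 1 / ((norm x)\<^sup>2 + 1)"
    define c where "c = complex_of_real t * cinner y x"
    have "(\<lambda>n. norm (z - (s n + c *\<^sub>C x))) \<longlonglongrightarrow> norm (z - (m + c *\<^sub>C x))"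
      by (intro tendsto_intros m)
    then have "d \<le> norm (z - (m + c *\<^sub>C x))"
      by (rule LIMSEQ_le_const) (use d_le M_add M_scale s(1) x in blast)
    then have "norm y \<le> norm (y - c *\<^sub>C x)"
      using \<open>norm y \<le> d\<close> by (simp add: y_def algebra_simps)
    then have "(norm y)\<^sup>2 \<le> (norm (y - c *\<^sub>C x))\<^sup>2" by (intro power_mono) auto
    moreover have "Re (cinner y (c *\<^sub>C x)) = t * p"
      by (simp add: c_def cinner_scaleC_right p_def cmod_power2) (simp add: power2_eq_square algebra_simps)
    moreover have "(norm (c *\<^sub>C x))\<^sup>2 = t\<^sup>2 * p * (norm x)\<^sup>2"
      by (simp add: norm_scaleC c_def p_def norm_mult power_mult_distrib)
    ultimately have "2 * t * p \<le> t\<^sup>2 * p * (norm x)\<^sup>2" by (simp add: norm_diff_sq)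
    moreover have t: "t > 0" by (simp add: t_def add_nonneg_pos)
    ultimately have "(t * p) * 2 \<le> (t * p) * (t * (norm x)\<^sup>2)"
      by (simp add: power2_eq_square mult_ac)
    then have "2 \<le> t * (norm x)\<^sup>2" using t p by (simp add: mult_le_cancel_left)
    moreover have "t * (norm x)\<^sup>2 \<le> 1"
      by (simp add: t_def add_nonneg_pos divide_le_eq)
    ultimately show False by simp
  qed
  ultimately show ?thesis by blast
qed

corollary dense_if_orthogonal_trivial:
  fixes M :: "'a::complex_hilbert set"
  assumes "csubspace M" "\<And>y. (\<And>x. x \<in> M \<Longrightarrow> cinner x y = 0) \<Longrightarrow> y = 0"
  shows "closure M = UNIV"
proof -
  have "z \<in> closure M" for z
    using orthogonal_projection_exists[OF assms(1), of z] assms(2) by force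
  then show ?thesis by blast
qed

lemma orthogonal_to_dense_eq_0:
  fixes y :: "'a::complex_inner"
  assumes "closure M = UNIV" "\<And>x. x \<in> M \<Longrightarrow> cinner x y = 0"
  shows "y = 0"
proof -
  obtain s where s: "\<And>n. s n \<in> M" "s \<longlonglongrightarrow> y"
    using assms(1) closure_sequential by blast
  have "(\<lambda>n. cinner (s n) y) \<longlonglongrightarrow> cinner y y"
    by (intro tendsto_intros s)
  then have "cinner y y = 0" using s(1) assms(2) by (simp add: LIMSEQ_const_iff)
  then show ?thesis by (simp add: cinner_self)
qed

text \<open>
  A functional is determined by its kernel up to a factor, and the orthogonal complement of the
  kernel is a line: any vector on it, suitably scaled, represents the functional.
\<close>

lemma Riesz_representation:
  fixes f :: "'a::complex_hilbert \<Rightarrow> complex"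
  assumes f: "bounded_clinear f"
  shows "\<exists>z. \<forall>x. f x = cinner x z"
proof (cases "\<forall>x. f x = 0")
  case True
  then show ?thesis by (intro exI[of _ 0]) simp
next
  case False
  then obtain x0 where x0: "f x0 \<noteq> 0" by blast
  note f_simps = bounded_clinear_simps[OF f] scaleC_complex_def
  let ?M = "{x. f x = 0}"
  have M: "csubspace ?M" by (simp add: csubspace_def f_simps)
  have "closed ?M"
    using f by (intro closed_Collect_eq continuous_on_const)
      (simp add: bounded_clinear_def linear_continuous_on)
  obtain m where m: "m \<in> closure ?M" "\<And>x. f x = 0 \<Longrightarrow> cinner x (x0 - m) = 0"
    using orthogonal_projection_exists[OF M, of x0] by blast
  define y where "y = x0 - m"
  have "f m = 0" using m(1) \<open>closed ?M\<close> by simp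
  then have fy: "f y \<noteq> 0" using x0 by (simp add: y_def f_simps)
  then have y: "cinner y y \<noteq> 0" using f_simps(4) by (auto simp: cinner_self)
  have "f x = cinner x ((cnj (f y / cinner y y)) *\<^sub>C y)" for x
  proof -
    have "f (x - (f x / f y) *\<^sub>C y) = 0" using fy by (simp add: f_simps)
    then have "cinner (x - (f x / f y) *\<^sub>C y) y = 0" using m(2) by (simp add: y_def)
    then have "cinner x y = f x / f y * cinner y y"
      by (simp add: cinner_diff_left cinner_scaleC_left)
    then show ?thesis using fy y by (simp add: cinner_scaleC_right)
  qed
  then show ?thesis by blast
qed

lemma cinner_cadjoint:
  fixes W :: "'a::complex_hilbert \<Rightarrow> 'b::complex_inner"
  assumes W: "bounded_clinear W"
  shows "cinner (W x) y = cinner x (cadjoint W y)"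
proof -
  have "bounded_clinear (\<lambda>x. cinner (W x) y)"
    using W bounded_bilinear.bounded_linear_left[OF bounded_bilinear_cinner, of y]
    by (auto simp: bounded_clinear_def cinner_scaleC_left scaleC_complex_def
        intro: bounded_linear_compose)
  then obtain z where z: "\<forall>x. cinner (W x) y = cinner x z"
    using Riesz_representation by blast
  have "z' = z" if "\<forall>x. cinner (W x) y = cinner x z'" for z'
  proof -
    have "cinner (z' - z) (z' - z) = 0" using z that by (simp add: cinner_diff_right)
    then show ?thesis by (simp add: cinner_self)
  qed
  then have "cadjoint W y = z"
    unfolding cadjoint_def using z by (intro the_equality) auto
  then show ?thesis using z by simp
qed

lemma cadjoint_eqI:
  fixes W :: "'a::complex_hilbert \<Rightarrow> 'b::complex_inner"
  assumes "bounded_clinear W" "\<And>x. cinner (W x) y = cinner x z"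
  shows "cadjoint W y = z"
proof -
  have "cinner (cadjoint W y - z) (cadjoint W y - z) = 0"
    using assms(2) cinner_cadjoint[OF assms(1)] by (simp add: cinner_diff_right)
  then show ?thesis by (simp add: cinner_self)
qed

text \<open>A vector orthogonal to the range of \<open>S\<^sup>*\<close> is annihilated by \<open>S\<close>.\<close>

lemma range_cadjoint_dense:
  fixes S :: "'a::complex_hilbert \<Rightarrow> 'b::complex_hilbert"
  assumes S: "bounded_clinear S" and "inj S"
  shows "closure (range (cadjoint S)) = UNIV"
proof (rule dense_if_orthogonal_trivial)
  note adj = cinner_cadjoint[OF S, symmetric]
  have zero: "cadjoint S 0 = 0" by (rule cadjoint_eqI[OF S]) simp
  have add: "cadjoint S k + cadjoint S l = cadjoint S (k + l)" for k l
    by (rule sym, rule cadjoint_eqI[OF S]) (simp add: cinner_add_right adj)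
  have scale: "c *\<^sub>C cadjoint S k = cadjoint S (c *\<^sub>C k)" for c k
    by (rule sym, rule cadjoint_eqI[OF S]) (simp add: cinner_scaleC_right adj)
  have "0 \<in> range (cadjoint S)" by (subst zero[symmetric]) (rule rangeI)
  then show "csubspace (range (cadjoint S))"
    by (auto simp: csubspace_def add scale)
next
  fix y assume "\<And>x. x \<in> range (cadjoint S) \<Longrightarrow> cinner x y = 0"
  then have "cinner y (cadjoint S (S y)) = 0"
    using cinner_commute[of y "cadjoint S (S y)"] by simp
  then have "S y = 0" by (simp add: cinner_cadjoint[OF S, symmetric] cinner_self)
  then show "y = 0"
    using \<open>inj S\<close> bounded_clinear_simps(4)[OF S] by (metis injD)
qed


section \<open>Generation of contraction semigroups\<close>

lemma norm_funpow_le: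
  fixes U :: "'a::real_normed_vector \<Rightarrow> 'a"
  assumes "\<And>x. norm (U x) \<le> norm x"
  shows "norm ((U ^^ n) x) \<le> norm x"
  by (induction n) (auto intro: order_trans[OF assms])

lemma bounded_clinear_id: "bounded_clinear (id :: 'a::complex_inner \<Rightarrow> 'a)"
  unfolding bounded_clinear_def id_def by (intro conjI bounded_linear_ident) simp

lemma bounded_clinear_funpow:
  fixes U :: "'a::complex_inner \<Rightarrow> 'a"
  assumes "bounded_clinear U"
  shows "bounded_clinear (U ^^ n)"
proof (induction n)
  case 0
  have "U ^^ 0 = id" by auto
  then show ?case by (simp only: bounded_clinear_id)
next
  case (Suc n)
  then show ?case
    using assms bounded_linear_compose[of U "U ^^ n"] by (simp add: bounded_clinear_def o_def)
qed

text \<open>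
  Telescoping: \<open>U\<^sup>n - V\<^sup>n\<close> is a sum of \<open>n\<close> terms \<open>U\<^sup>i V\<^sup>j (U - V)\<close>, each of norm at most that of \<open>U - V\<close>.
\<close>

lemma norm_funpow_diff_le:
  fixes U V :: "'a::complex_inner \<Rightarrow> 'a"
  assumes U: "bounded_clinear U" "\<And>x. norm (U x) \<le> norm x"
    and V: "bounded_clinear V" "\<And>x. norm (V x) \<le> norm x"
    and comm: "\<And>x. U (V x) = V (U x)"
  shows "norm ((U ^^ n) x - (V ^^ n) x) \<le> real n * norm (U x - V x)"
proof (induction n)
  case (Suc n)
  have comm_n: "U ((V ^^ m) y) = (V ^^ m) (U y)" for m y
    by (induction m) (simp_all add: comm)
  have "(U ^^ Suc n) x - (V ^^ Suc n) x
      = U ((U ^^ n) x - (V ^^ n) x) + (V ^^ n) (U x - V x)"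
    by (simp add: bounded_clinear_simps[OF U(1)] bounded_clinear_simps[OF bounded_clinear_funpow[OF V(1)]]
        comm_n funpow_swap1)
  also have "norm \<dots> \<le> norm ((U ^^ n) x - (V ^^ n) x) + norm (U x - V x)"
    by (intro norm_triangle_mono U(2) norm_funpow_le V(2))
  also have "\<dots> \<le> real (Suc n) * norm (U x - V x)"
    using Suc by (simp add: algebra_simps)
  finally show ?case .
qed simp

text \<open>
  Equicontinuity, here a common Lipschitz constant \<open>1\<close>, carries convergence from a dense set to the
  whole space. The limits are known in the first case, and only their existence is at stake in the
  second.
\<close>

lemma tendsto_on_dense:
  fixes S :: "'c \<Rightarrow> 'a::real_normed_vector \<Rightarrow> 'a"
  assumes dense: "closure D = UNIV"
    and S: "\<forall>\<^sub>F h in F. \<forall>x y. norm (S h x - S h y) \<le> norm (x - y)"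
    and D: "\<And>x. x \<in> D \<Longrightarrow> ((\<lambda>h. S h x) \<longlongrightarrow> x) F"
  shows "((\<lambda>h. S h x) \<longlongrightarrow> x) F"
proof (rule tendstoI)
  fix e :: real assume e: "0 < e"
  obtain y where y: "y \<in> D" "dist y x < e / 3"
    using dense e closure_approachable[of x D] by (metis UNIV_I divide_pos_pos zero_less_numeral)
  have "\<forall>\<^sub>F h in F. dist (S h y) y < e / 3"
    using e by (intro tendstoD[OF D[OF y(1)]]) simp
  with S show "\<forall>\<^sub>F h in F. dist (S h x) x < e"
  proof eventually_elim
    case (elim h)
    have "dist (S h x) (S h y) \<le> dist x y" using elim by (simp add: dist_norm)
    then show ?case
      using elim(2) y(2) dist_triangle[of "S h x" x "S h y"] dist_triangle[of "S h y" x y]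
      by (simp add: dist_commute)
  qed
qed

lemma Cauchy_on_dense:
  fixes S :: "nat \<Rightarrow> 'a::real_normed_vector \<Rightarrow> 'a"
  assumes dense: "closure D = UNIV"
    and S: "\<And>k x y. norm (S k x - S k y) \<le> norm (x - y)"
    and D: "\<And>x. x \<in> D \<Longrightarrow> Cauchy (\<lambda>k. S k x)"
  shows "Cauchy (\<lambda>k. S k x)"
proof (rule metric_CauchyI)
  fix e :: real assume e: "0 < e"
  obtain y where y: "y \<in> D" "dist y x < e / 3"
    using dense e closure_approachable[of x D] by (metis UNIV_I divide_pos_pos zero_less_numeral)
  obtain N where N: "\<And>i j. i \<ge> N \<Longrightarrow> j \<ge> N \<Longrightarrow> dist (S i y) (S j y) < e / 3"
    using metric_CauchyD[OF D[OF y(1)]] e by (metis divide_pos_pos zero_less_numeral)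
  have "dist (S i x) (S j x) < e" if "i \<ge> N" "j \<ge> N" for i j
  proof -
    have "dist (S k x) (S k y) \<le> dist x y" for k using S by (simp add: dist_norm)
    from this[of i] this[of j] show ?thesis
      using N[OF that] y(2) dist_triangle[of "S i x" "S j x" "S i y"]
        dist_triangle[of "S i y" "S j x" "S j y"]
      by (simp add: dist_commute)
  qed
  then show "\<exists>N. \<forall>i\<ge>N. \<forall>j\<ge>N. dist (S i x) (S j x) < e" by blast
qed

lemma generator_tendsto:
  assumes "generator T x = Some y"
  shows "((\<lambda>t. (T t x - x) /\<^sub>R t) \<longlongrightarrow> y) (at_right 0)"
  using assms tendsto_Lim[OF trivial_limit_at_right_real] by (auto simp: generator_def split: if_splits)

lemma generator_eqI:
  assumes "((\<lambda>t. (T t x - x) /\<^sub>R t) \<longlongrightarrow> y) (at_right 0)"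
  shows "generator T x = Some y"
  using assms tendsto_Lim[OF trivial_limit_at_right_real assms] by (auto simp: generator_def)

lemma dissipative_generator:
  fixes T :: "real \<Rightarrow> 'a::complex_inner \<Rightarrow> 'a"
  assumes "contraction_semigroup T"
  shows "dissipative (generator T)"
  unfolding dissipative_def
proof
  fix x assume "x \<in> dom (generator T)"
  then obtain y where y: "generator T x = Some y" by blast
  have "((\<lambda>t. Re (cinner x ((T t x - x) /\<^sub>R t))) \<longlongrightarrow> Re (cinner x y)) (at_right 0)"
    by (intro tendsto_intros generator_tendsto y)
  moreover have "Re (cinner x ((T t x - x) /\<^sub>R t)) \<le> 0" if "t > 0" for t
  proof -
    have "norm (T t x) \<le> norm x" using assms that by (simp add: contraction_semigroup_def)
    then have "Re (cinner x (T t x)) \<le> norm x * norm x"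
      using Re_cinner_le[of x "T t x"] by (meson mult_left_mono norm_ge_zero order_trans)
    then show ?thesis
      using that by (simp add: cinner_scaleR_right cinner_diff_right cinner_self power2_eq_square
          mult_nonneg_nonpos)
  qed
  then have "\<forall>\<^sub>F t in at_right 0. Re (cinner x ((T t x - x) /\<^sub>R t)) \<le> 0"
    using eventually_at_right_less by (rule eventually_mono[rotated])
  ultimately have "Re (cinner x y) \<le> 0"
    by (rule tendsto_upperbound) simp
  then show "Re (cinner x (the (generator T x))) \<le> 0" using y by simp
qed

lemma dissipative_norm_le:
  assumes "dissipative A" "x \<in> dom A" "0 \<le> h"
  shows "norm x \<le> norm (x - h *\<^sub>R the (A x))"
proof (cases "x = 0")
  case False
  have "h * Re (cinner x (the (A x))) \<le> 0"
    using assms by (simp add: dissipative_def mult_nonneg_nonpos)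
  then have "norm x * norm x \<le> Re (cinner x (x - h *\<^sub>R the (A x)))"
    by (simp add: cinner_diff_right cinner_scaleR_right Re_cinner_self power2_eq_square)
  also have "\<dots> \<le> norm x * norm (x - h *\<^sub>R the (A x))" by (rule Re_cinner_le)
  finally show ?thesis using False by simp
qed simp

text \<open>
  The content of this locale is the Hille-Yosida construction: its assumptions say that
  \<open>(1 - h A)\<^sup>-\<^sup>1\<close> is an everywhere defined contraction for every \<open>h > 0\<close>.
\<close>

locale m_dissipative =
  fixes A :: "'a::complex_hilbert \<rightharpoonup> 'a"
  assumes linear: "linear_operator A"
    and dense: "densely_defined A"
    and dissip: "dissipative A"
    and onto: "\<And>h y. 0 < h \<Longrightarrow> \<exists>x\<in>dom A. x - h *\<^sub>R the (A x) = y"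
begin

abbreviation op :: "'a \<Rightarrow> 'a" where "op x \<equiv> the (A x)"

lemma dom_closed:
  "0 \<in> dom A"
  "x \<in> dom A \<Longrightarrow> y \<in> dom A \<Longrightarrow> x + y \<in> dom A"
  "x \<in> dom A \<Longrightarrow> c *\<^sub>C x \<in> dom A"
  "x \<in> dom A \<Longrightarrow> r *\<^sub>R x \<in> dom A"
  "x \<in> dom A \<Longrightarrow> y \<in> dom A \<Longrightarrow> x - y \<in> dom A"
proof -
  show C: "x \<in> dom A \<Longrightarrow> c *\<^sub>C x \<in> dom A" for x c
    using linear unfolding linear_operator_def by blast
  show R: "x \<in> dom A \<Longrightarrow> r *\<^sub>R x \<in> dom A" for x r
    using C[of x "complex_of_real r"] by (simp add: scaleC_of_real)
  show P: "x \<in> dom A \<Longrightarrow> y \<in> dom A \<Longrightarrow> x + y \<in> dom A" for x y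
    using linear unfolding linear_operator_def by blast
  show "x \<in> dom A \<Longrightarrow> y \<in> dom A \<Longrightarrow> x - y \<in> dom A"
    using P[of x "-1 *\<^sub>R y"] R[of y "-1"] by simp
  show "0 \<in> dom A" using linear unfolding linear_operator_def by blast
qed

lemma op_simps:
  "x \<in> dom A \<Longrightarrow> y \<in> dom A \<Longrightarrow> op (x + y) = op x + op y"
  "x \<in> dom A \<Longrightarrow> op (c *\<^sub>C x) = c *\<^sub>C op x"
  "x \<in> dom A \<Longrightarrow> op (r *\<^sub>R x) = r *\<^sub>R op x"
  "x \<in> dom A \<Longrightarrow> y \<in> dom A \<Longrightarrow> op (x - y) = op x - op y"
proof -
  show C: "x \<in> dom A \<Longrightarrow> op (c *\<^sub>C x) = c *\<^sub>C op x" for x c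
    using linear unfolding linear_operator_def by blast
  show R: "x \<in> dom A \<Longrightarrow> op (r *\<^sub>R x) = r *\<^sub>R op x" for x r
    using C[of x "complex_of_real r"] by (simp add: scaleC_of_real)
  show P: "x \<in> dom A \<Longrightarrow> y \<in> dom A \<Longrightarrow> op (x + y) = op x + op y" for x y
    using linear unfolding linear_operator_def by blast
  show "x \<in> dom A \<Longrightarrow> y \<in> dom A \<Longrightarrow> op (x - y) = op x - op y"
    using P[of x "-1 *\<^sub>R y"] R[of y "-1"] dom_closed(4)[of y "-1"] by simp
qed

text \<open>
  At \<open>h = 0\<close> the equation \<open>x - h A x = y\<close> is solvable for \<open>y \<in> dom A\<close> only; the identity is the
  continuous extension, and with it the estimates below hold down to \<open>h = 0\<close>.
\<close>

definition resolvent :: "real \<Rightarrow> 'a \<Rightarrow> 'a" where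
  "resolvent h y = (if h = 0 then y else (SOME x. x \<in> dom A \<and> x - h *\<^sub>R op x = y))"

lemma resolvent_0 [simp]: "resolvent 0 x = x"
  by (simp add: resolvent_def)

lemma resolvent:
  assumes "0 < h"
  shows "resolvent h y \<in> dom A" "resolvent h y - h *\<^sub>R op (resolvent h y) = y"
proof -
  have "\<exists>x. x \<in> dom A \<and> x - h *\<^sub>R op x = y" using onto[OF assms] by blast
  from someI_ex[OF this]
  show "resolvent h y \<in> dom A" "resolvent h y - h *\<^sub>R op (resolvent h y) = y"
    using assms by (simp_all add: resolvent_def)
qed

lemma resolvent_unique:
  assumes "0 \<le> h" "x \<in> dom A"
  shows "resolvent h (x - h *\<^sub>R op x) = x"
proof (cases "h = 0")
  case False
  then have h: "0 < h" using assms by simp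
  define u where "u = resolvent h (x - h *\<^sub>R op x)"
  have u: "u \<in> dom A" "u - h *\<^sub>R op u = x - h *\<^sub>R op x"
    using resolvent[OF h] by (simp_all add: u_def)
  have "norm (u - x) \<le> norm ((u - x) - h *\<^sub>R op (u - x))"
    using dissipative_norm_le[OF dissip] dom_closed u assms by blast
  also have "(u - x) - h *\<^sub>R op (u - x) = 0"
    using u assms by (simp add: op_simps algebra_simps)
  finally show ?thesis by (simp add: u_def)
qed simp

lemma resolvent_contraction:
  assumes "0 \<le> h"
  shows "norm (resolvent h x) \<le> norm x"
proof (cases "h = 0")
  case False
  then have h: "0 < h" using assms by simp
  show ?thesis
    using dissipative_norm_le[OF dissip resolvent(1)[OF h] assms, of x] resolvent(2)[OF h, of x]
    by simp
qed simp

lemma resolvent_clinear: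
  assumes "0 \<le> h"
  shows "bounded_clinear (resolvent h)"
proof (cases "h = 0")
  case True
  then have "resolvent h = id" by auto
  then show ?thesis by (simp only: bounded_clinear_id)
next
  case False
  then have h: "0 < h" using assms by simp
  have eqI: "resolvent h y = x" if "x \<in> dom A" "y = x - h *\<^sub>R op x" for x y
    using resolvent_unique[OF assms that(1)] that(2) by simp
  note R = resolvent[OF h]
  have add: "resolvent h (x + y) = resolvent h x + resolvent h y" for x y
  proof (intro eqI dom_closed R(1))
    have "x + y = (resolvent h x - h *\<^sub>R op (resolvent h x))
        + (resolvent h y - h *\<^sub>R op (resolvent h y))"
      by (simp only: R(2))
    also have "\<dots> = resolvent h x + resolvent h y - h *\<^sub>R op (resolvent h x + resolvent h y)"
      by (simp add: op_simps R(1) algebra_simps)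
    finally show "x + y = \<dots>" .
  qed
  have scale: "resolvent h (c *\<^sub>C x) = c *\<^sub>C resolvent h x" for x c
    using arg_cong[OF R(2)[of x], of "\<lambda>z. c *\<^sub>C z"]
    by (intro eqI dom_closed R(1)) (simp add: op_simps R(1) scaleC_diff_right scaleR_scaleC_commute)
  have "resolvent h (r *\<^sub>R x) = r *\<^sub>R resolvent h x" for x r
    using scale[of "complex_of_real r" x] by (simp add: scaleC_of_real)
  then have "bounded_linear (resolvent h)"
    using add resolvent_contraction[OF assms] by (intro bounded_linear_intro[where K=1]) auto
  then show ?thesis using scale by (simp add: bounded_clinear_def)
qed

lemmas resolvent_simps = bounded_clinear_simps[OF resolvent_clinear]

text \<open>
  The value \<open>A u = (u - x) / h\<close> at \<open>u = resolvent h x\<close> is again in \<open>dom A\<close> when \<open>x\<close> is, so \<open>A\<close> may be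
  applied to the equation \<open>u - h A u = x\<close>.
\<close>

lemma resolvent_dom:
  assumes "0 \<le> h" "x \<in> dom A"
  shows "resolvent h x \<in> dom A" "op (resolvent h x) = resolvent h (op x)"
proof -
  have "resolvent h x \<in> dom A \<and> op (resolvent h x) = resolvent h (op x)"
  proof (cases "h = 0")
    case True
    then show ?thesis using assms by simp
  next
    case False
    then have h: "0 < h" using assms by simp
    define u where "u = resolvent h x"
    have u: "u \<in> dom A" "u - h *\<^sub>R op u = x" using resolvent[OF h] by (simp_all add: u_def)
    have "op u = (1 / h) *\<^sub>R (u - x)" using h by (simp flip: u(2))
    then have Au: "op u \<in> dom A" using dom_closed u(1) assms(2) by metis
    have "op x = op u - h *\<^sub>R op (op u)"
      using arg_cong[OF u(2), of op] by (simp add: op_simps u(1) Au dom_closed)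
    then show ?thesis
      using resolvent_unique[OF assms(1) Au] u(1) by (simp flip: u_def)
  qed
  then show "resolvent h x \<in> dom A" "op (resolvent h x) = resolvent h (op x)" by blast+
qed

lemma resolvent_expansion:
  assumes "0 \<le> h" "x \<in> dom A"
  shows "resolvent h x = x + h *\<^sub>R resolvent h (op x)"
  using resolvent_unique[OF assms] assms(1) by (simp add: resolvent_simps algebra_simps)

lemma resolvent_commute:
  assumes "0 \<le> a" "0 \<le> b"
  shows "resolvent a (resolvent b x) = resolvent b (resolvent a x)"
proof (cases "a = 0 \<or> b = 0")
  case False
  then have b: "0 < b" using assms by simp
  define u where "u = resolvent b x"
  have u: "u \<in> dom A" "u - b *\<^sub>R op u = x" using resolvent[OF b] by (simp_all add: u_def)
  have "resolvent a u - b *\<^sub>R op (resolvent a u) = resolvent a (u - b *\<^sub>R op u)"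
    by (simp add: resolvent_dom u(1) assms resolvent_simps)
  then have "resolvent b (resolvent a x) = resolvent a u"
    using resolvent_unique[OF assms(2) resolvent_dom(1)[OF assms(1) u(1)]] by (simp add: u(2))
  then show ?thesis by (simp add: u_def)
qed auto

definition dom2 :: "'a set" where
  "dom2 = {x \<in> dom A. op x \<in> dom A}"

text \<open>
  Splitting a time step costs \<open>ab\<close>: \<open>(1 - aA)(1 - bA)\<close> and \<open>1 - (a + b)A\<close> differ by \<open>ab A\<^sup>2\<close>.
\<close>

lemma resolvent_add_le:
  assumes "0 \<le> a" "0 \<le> b" "x \<in> dom2"
  shows "norm (resolvent a (resolvent b x) - resolvent (a + b) x) \<le> a * b * norm (op (op x))"
proof -
  have ab: "0 \<le> a + b" using assms by simp
  have x: "x \<in> dom A" "op x \<in> dom A" using assms by (auto simp: dom2_def)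
  define u where "u = resolvent (a + b) x"
  have u: "u \<in> dom A" "op u = resolvent (a + b) (op x)" "op u \<in> dom A"
    "op (op u) = resolvent (a + b) (op (op x))"
    using resolvent_dom[OF ab] x by (simp_all add: u_def)
  have u_eq: "u - (a + b) *\<^sub>R op u = x"
    using resolvent_expansion[OF ab x(1)] u by (simp add: u_def[symmetric])
  define v where "v = u - b *\<^sub>R op u"
  have v: "v \<in> dom A" unfolding v_def by (intro dom_closed u)
  have "v - a *\<^sub>R op v = (u - (a + b) *\<^sub>R op u) + (a * b) *\<^sub>R op (op u)"
    using u by (simp add: v_def op_simps dom_closed algebra_simps)
  then have "resolvent a (x + (a * b) *\<^sub>R op (op u)) = v"
    using resolvent_unique[OF assms(1) v] by (simp add: u_eq)
  moreover have "resolvent b v = u"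
    unfolding v_def by (rule resolvent_unique[OF assms(2) u(1)])
  ultimately have "u = resolvent b (resolvent a (x + (a * b) *\<^sub>R op (op u)))" by simp
  also have "\<dots> = resolvent a (resolvent b x)
      + (a * b) *\<^sub>R resolvent b (resolvent a (op (op u)))"
    by (simp add: resolvent_simps assms resolvent_commute)
  finally have "norm (resolvent a (resolvent b x) - u)
      = norm ((a * b) *\<^sub>R resolvent b (resolvent a (op (op u))))"
    by (metis add_diff_cancel_left' norm_minus_commute)
  also have "\<dots> = a * b * norm (resolvent b (resolvent a (op (op u))))"
    using assms by simp
  also have "\<dots> \<le> a * b * norm (op (op x))"
    unfolding u(4) using assms
    by (intro mult_left_mono order_trans[OF resolvent_contraction] order_refl) auto
  finally show ?thesis by (simp add: u_def)
qed

lemma resolvent_near_id: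
  assumes "0 \<le> h" "x \<in> dom A"
  shows "norm (resolvent h x - x) \<le> h * norm (op x)"
  using assms resolvent_contraction[OF assms(1), of "op x"]
  by (simp add: resolvent_expansion[OF assms] mult_left_mono)

lemma resolvent_tendsto: "((\<lambda>h. resolvent h x) \<longlongrightarrow> x) (at_right 0)"
proof (rule tendsto_on_dense)
  show "closure (dom A) = UNIV" using dense by (simp add: densely_defined_def)
  show "\<forall>\<^sub>F h in at_right 0. \<forall>x y. norm (resolvent h x - resolvent h y) \<le> norm (x - y)"
    using eventually_at_right_less
    by eventually_elim (simp add: resolvent_contraction flip: resolvent_simps(2))
  fix x assume x: "x \<in> dom A"
  have "((\<lambda>h. resolvent h x - x) \<longlongrightarrow> 0) (at_right 0)"
  proof (rule Lim_null_comparison)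
    show "\<forall>\<^sub>F h in at_right 0. norm (resolvent h x - x) \<le> h * norm (op x)"
      using eventually_at_right_less by eventually_elim (simp add: resolvent_near_id x)
    show "((\<lambda>h. h * norm (op x)) \<longlongrightarrow> 0) (at_right 0)"
      by (auto intro!: tendsto_eq_intros)
  qed
  then show "((\<lambda>h. resolvent h x) \<longlongrightarrow> x) (at_right 0)" by (rule LIM_zero_cancel)
qed

text \<open>Resolvents push \<open>dom A\<close> into the domain of \<open>A\<^sup>2\<close> and converge to the identity.\<close>

lemma dom2_dense: "closure dom2 = UNIV"
proof -
  have "x \<in> closure dom2" if "x \<in> dom A" for x
  proof (rule Lim_in_closed_set)
    show "\<forall>\<^sub>F h in at_right 0. resolvent h x \<in> closure dom2"
      using eventually_at_right_less
    proof eventually_elim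
      case (elim h)
      then have "resolvent h x \<in> dom2" using that resolvent by (simp add: dom2_def resolvent_dom)
      then show ?case using closure_subset by blast
    qed
  qed (use resolvent_tendsto in auto)
  then have "closure (dom A) \<subseteq> closure dom2" by (intro closure_minimal) auto
  then show ?thesis using dense by (auto simp: densely_defined_def)
qed

text \<open>
  The implicit Euler scheme with \<open>2\<^sup>k\<close> equal steps; doubling the number of steps splits each step in
  two equal halves, so that consecutive schemes are easy to compare.
\<close>

definition euler :: "nat \<Rightarrow> real \<Rightarrow> 'a \<Rightarrow> 'a" where
  "euler k t = resolvent (t / 2 ^ k) ^^ (2 ^ k)"

lemma euler_clinear: "0 \<le> t \<Longrightarrow> bounded_clinear (euler k t)"
  unfolding euler_def by (intro bounded_clinear_funpow resolvent_clinear) simp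

lemma euler_contraction: "0 \<le> t \<Longrightarrow> norm (euler k t x) \<le> norm x"
  unfolding euler_def by (intro norm_funpow_le resolvent_contraction) simp

lemma euler_diff_le: "0 \<le> t \<Longrightarrow> norm (euler k t x - euler k t y) \<le> norm (x - y)"
  using euler_contraction[of t k "x - y"] by (simp add: bounded_clinear_simps[OF euler_clinear])

lemma bounded_clinear_comp_resolvent:
  assumes "0 \<le> a" "0 \<le> b"
  shows "bounded_clinear (resolvent a \<circ> resolvent b)"
  using resolvent_clinear[OF assms(1)] resolvent_clinear[OF assms(2)]
    bounded_linear_compose[of "resolvent a" "resolvent b"]
  by (simp add: bounded_clinear_def o_def)

lemma resolvent_comp_funpow_diff_le:
  assumes "0 \<le> a" "0 \<le> b" "x \<in> dom2"
  shows "norm (((resolvent a \<circ> resolvent b) ^^ n) x - (resolvent (a + b) ^^ n) x)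
    \<le> real n * (a * b * norm (op (op x)))"
proof -
  have "norm (((resolvent a \<circ> resolvent b) ^^ n) x - (resolvent (a + b) ^^ n) x)
      \<le> real n * norm ((resolvent a \<circ> resolvent b) x - resolvent (a + b) x)"
  proof (rule norm_funpow_diff_le)
    show "norm ((resolvent a \<circ> resolvent b) x) \<le> norm x" for x
      using assms by (auto intro: order_trans[OF resolvent_contraction resolvent_contraction])
    show "(resolvent a \<circ> resolvent b) (resolvent (a + b) x)
        = resolvent (a + b) ((resolvent a \<circ> resolvent b) x)" for x
      using assms by (simp add: resolvent_commute[of a "a + b"] resolvent_commute[of b "a + b"])
  qed (use assms in \<open>auto intro: bounded_clinear_comp_resolvent resolvent_clinear resolvent_contraction\<close>)
  also have "\<dots> \<le> real n * (a * b * norm (op (op x)))"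
    using resolvent_add_le[OF assms] by (intro mult_left_mono) auto
  finally show ?thesis .
qed

lemma euler_Suc_diff_le:
  assumes "0 \<le> t" "x \<in> dom2"
  shows "norm (euler (Suc k) t x - euler k t x) \<le> t\<^sup>2 / 4 * norm (op (op x)) * (1/2) ^ k"
proof -
  define h where "h = t / 2 ^ Suc k"
  have h: "0 \<le> h" "t / 2 ^ k = h + h" using assms by (simp_all add: h_def)
  have "euler (Suc k) t = (resolvent h ^^ 2) ^^ (2 ^ k)"
    by (simp add: euler_def h_def funpow_mult mult.commute)
  also have "resolvent h ^^ 2 = resolvent h \<circ> resolvent h"
    by (simp add: numeral_2_eq_2)
  finally have "norm (euler (Suc k) t x - euler k t x) \<le> real (2 ^ k) * (h * h * norm (op (op x)))"
    using resolvent_comp_funpow_diff_le[OF h(1) h(1) assms(2), of "2 ^ k"]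
    by (simp only: euler_def[of k] h(2))
  also have "\<dots> = t\<^sup>2 / 4 * norm (op (op x)) * (1/2) ^ k"
    by (simp add: h_def power2_eq_square field_simps)
  finally show ?thesis .
qed

text \<open>
  Summing the geometric series of the errors, with the part beyond \<open>k + j\<close> kept so that the bound is
  inductive.
\<close>

lemma euler_diff_bound:
  assumes "0 \<le> t" "x \<in> dom2"
  shows "norm (euler (k + j) t x - euler k t x)
    \<le> t\<^sup>2 / 2 * norm (op (op x)) * ((1/2) ^ k - (1/2) ^ (k + j))"
proof (induction j)
  case (Suc j)
  have "norm (euler (k + Suc j) t x - euler k t x)
      \<le> norm (euler (Suc (k + j)) t x - euler (k + j) t x) + norm (euler (k + j) t x - euler k t x)"
    using norm_triangle_ineq[of "euler (Suc (k + j)) t x - euler (k + j) t x"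
        "euler (k + j) t x - euler k t x"] by simp
  also have "\<dots> \<le> t\<^sup>2 / 4 * norm (op (op x)) * (1/2) ^ (k + j)
      + t\<^sup>2 / 2 * norm (op (op x)) * ((1/2) ^ k - (1/2) ^ (k + j))"
    by (intro add_mono euler_Suc_diff_le assms Suc)
  also have "\<dots> = t\<^sup>2 / 2 * norm (op (op x)) * ((1/2) ^ k - (1/2) ^ (k + Suc j))"
    by (simp add: algebra_simps)
  finally show ?case .
qed simp

lemma euler_Cauchy:
  assumes "0 \<le> t"
  shows "Cauchy (\<lambda>k. euler k t x)"
proof (rule Cauchy_on_dense[OF dom2_dense])
  show "norm (euler k t x - euler k t y) \<le> norm (x - y)" for k x y
    by (rule euler_diff_le[OF assms])
  fix x assume x: "x \<in> dom2"
  define C where "C = t\<^sup>2 / 2 * norm (op (op x))"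
  have C: "0 \<le> C" by (simp add: C_def)
  have bound: "dist (euler m t x) (euler k t x) \<le> C * (1/2) ^ k" if "k \<le> m" for k m
  proof -
    have "dist (euler m t x) (euler k t x) \<le> C * ((1/2) ^ k - (1/2) ^ m)"
      using euler_diff_bound[OF assms x, of k "m - k"] that by (simp add: dist_norm C_def)
    also have "\<dots> \<le> C * (1/2) ^ k" using C by (intro mult_left_mono) auto
    finally show ?thesis .
  qed
  show "Cauchy (\<lambda>k. euler k t x)"
  proof (rule CauchyI')
    fix e :: real assume e: "0 < e"
    have "(\<lambda>k. C * (1/2) ^ k) \<longlonglongrightarrow> C * 0"
      by (intro tendsto_intros LIMSEQ_realpow_zero) auto
    then have "\<forall>\<^sub>F k in sequentially. C * (1/2) ^ k < e"
      using e by (intro order_tendstoD) auto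
    then obtain N where N: "\<And>k. k \<ge> N \<Longrightarrow> C * (1/2) ^ k < e"
      unfolding eventually_sequentially by blast
    have "dist (euler m t x) (euler n t x) < e" if "m \<ge> N" "n > m" for m n
      using bound[of m n] N[OF that(1)] that(2) by (simp add: dist_commute)
    then show "\<exists>M. \<forall>m\<ge>M. \<forall>n>m. dist (euler m t x) (euler n t x) < e" by blast
  qed
qed

definition flow :: "real \<Rightarrow> 'a \<Rightarrow> 'a" where
  "flow t x = lim (\<lambda>k. euler k t x)"

lemma euler_tendsto:
  assumes "0 \<le> t"
  shows "(\<lambda>k. euler k t x) \<longlonglongrightarrow> flow t x"
  unfolding flow_def
  using Cauchy_convergent[OF euler_Cauchy[OF assms]] by (simp add: convergent_LIMSEQ_iff)

lemma flow_eqI: "0 \<le> t \<Longrightarrow> (\<lambda>k. euler k t x) \<longlonglongrightarrow> y \<Longrightarrow> flow t x = y"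
  by (rule LIMSEQ_unique[OF euler_tendsto])

lemma flow_contraction:
  assumes "0 \<le> t"
  shows "norm (flow t x) \<le> norm x"
  by (rule LIMSEQ_le_const2[OF tendsto_norm[OF euler_tendsto[OF assms]]])
    (simp add: euler_contraction assms)

lemma flow_clinear:
  assumes "0 \<le> t"
  shows "bounded_clinear (flow t)"
proof -
  note lim = euler_tendsto[OF assms] and E = bounded_clinear_simps[OF euler_clinear[OF assms]]
  have "flow t (x + y) = flow t x + flow t y" for x y
    by (rule flow_eqI[OF assms]) (unfold E, intro tendsto_intros lim)
  moreover have "flow t (r *\<^sub>R x) = r *\<^sub>R flow t x" for r x
    by (rule flow_eqI[OF assms]) (unfold E, intro tendsto_intros lim)
  moreover have "flow t (c *\<^sub>C x) = c *\<^sub>C flow t x" for c x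
  proof (rule flow_eqI[OF assms])
    have "bounded_linear (\<lambda>z::'a. c *\<^sub>C z)"
      by (rule bounded_linear_intro[where K="cmod c"])
        (simp_all add: scaleC_add_right scaleR_scaleC_commute norm_scaleC mult.commute)
    then show "(\<lambda>k. euler k t (c *\<^sub>C x)) \<longlonglongrightarrow> c *\<^sub>C flow t x"
      unfolding E by (rule bounded_linear.tendsto) (rule lim)
  qed
  ultimately show ?thesis
    using flow_contraction[OF assms] unfolding bounded_clinear_def
    by (intro conjI bounded_linear_intro[where K=1]) auto
qed

lemma flow_diff_le: "0 \<le> t \<Longrightarrow> norm (flow t x - flow t y) \<le> norm (x - y)"
  using flow_contraction[of t "x - y"] by (simp add: bounded_clinear_simps[OF flow_clinear])

lemma flow_0: "flow 0 = id"
proof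
  have "(resolvent 0 ^^ n) x = x" for n x by (induction n) auto
  then have "euler k 0 x = x" for k x by (simp add: euler_def)
  then show "flow 0 x = id x" for x
    by (intro flow_eqI) auto
qed

text \<open>
  The schemes for \<open>s\<close>, \<open>t\<close> and \<open>s + t\<close> with the same number of steps differ in each step by the error
  of splitting \<open>(s + t) / 2\<^sup>k\<close> into \<open>s / 2\<^sup>k\<close> and \<open>t / 2\<^sup>k\<close>.
\<close>

lemma flow_add:
  assumes "0 \<le> s" "0 \<le> t"
  shows "flow (s + t) x = flow s (flow t x)"
proof -
  note st = add_nonneg_nonneg[OF assms]
  have on_dom2: "flow (s + t) x = flow s (flow t x)" if x: "x \<in> dom2" for x
  proof (rule flow_eqI[OF st])
    have "norm (euler k s (euler k t x) - euler k (s + t) x) \<le> s * t * norm (op (op x)) * (1/2) ^ k" for k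
    proof -
      define a b where "a = s / 2 ^ k" and "b = t / 2 ^ k"
      have ab: "0 \<le> a" "0 \<le> b" "(s + t) / 2 ^ k = a + b"
        using assms by (simp_all add: a_def b_def add_divide_distrib)
      have comm: "resolvent a ((resolvent b ^^ n) y) = (resolvent b ^^ n) (resolvent a y)" for n y
        by (induction n) (simp_all add: resolvent_commute[OF ab(1,2)])
      have "((resolvent a \<circ> resolvent b) ^^ n) y = (resolvent a ^^ n) ((resolvent b ^^ n) y)" for n y
        by (induction n arbitrary: y) (simp_all add: funpow_Suc_right comm del: funpow.simps)
      then have "norm (euler k s (euler k t x) - euler k (s + t) x) \<le> real (2 ^ k) * (a * b * norm (op (op x)))"
        using resolvent_comp_funpow_diff_le[OF ab(1,2) x, of "2 ^ k"]
        unfolding euler_def ab(3) by (simp add: a_def b_def)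
      also have "\<dots> = s * t * norm (op (op x)) * (1/2) ^ k"
        by (simp add: a_def b_def power_divide)
      finally show ?thesis .
    qed
    then have "\<forall>\<^sub>F k in sequentially. norm (euler k s (euler k t x) - euler k (s + t) x)
        \<le> s * t * norm (op (op x)) * (1/2) ^ k"
      by (intro always_eventually allI)
    moreover have "(\<lambda>k. s * t * norm (op (op x)) * (1/2) ^ k) \<longlonglongrightarrow> s * t * norm (op (op x)) * 0"
      by (intro tendsto_intros LIMSEQ_realpow_zero) auto
    ultimately have 1: "(\<lambda>k. euler k s (euler k t x) - euler k (s + t) x) \<longlonglongrightarrow> 0"
      unfolding mult_zero_right by (rule Lim_null_comparison)
    have "(\<lambda>k. euler k t x - flow t x) \<longlonglongrightarrow> 0"
      using euler_tendsto[OF assms(2)] by (simp add: LIM_zero_iff)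
    then have "(\<lambda>k. norm (euler k t x - flow t x)) \<longlonglongrightarrow> 0" by (rule tendsto_norm_zero)
    then have 2: "(\<lambda>k. euler k s (euler k t x) - euler k s (flow t x)) \<longlonglongrightarrow> 0"
      by (rule Lim_null_comparison[rotated]) (simp add: euler_diff_le assms)
    have "(\<lambda>k. euler k s (flow t x)
        + (euler k s (euler k t x) - euler k s (flow t x))
        - (euler k s (euler k t x) - euler k (s + t) x)) \<longlonglongrightarrow> flow s (flow t x) + 0 - 0"
      by (intro tendsto_add tendsto_diff 1 2 euler_tendsto assms)
    then show "(\<lambda>k. euler k (s + t) x) \<longlonglongrightarrow> flow s (flow t x)" by simp
  qed
  have cont: "continuous_on UNIV (flow r)" if "0 \<le> r" for r
    using flow_clinear[OF that] by (simp add: bounded_clinear_def linear_continuous_on)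
  have "closed {x. flow (s + t) x = flow s (flow t x)}"
    using continuous_on_compose2[OF cont[OF assms(1)] cont[OF assms(2)]]
    by (intro closed_Collect_eq cont st) auto
  then have "closure dom2 \<subseteq> {x. flow (s + t) x = flow s (flow t x)}"
    using on_dom2 by (intro closure_minimal) auto
  then show ?thesis using dom2_dense by auto
qed

lemma flow_near_id:
  assumes "0 \<le> t" "x \<in> dom A"
  shows "norm (flow t x - x) \<le> t * norm (op x)"
proof (rule LIMSEQ_le_const2)
  show "(\<lambda>k. norm (euler k t x - x)) \<longlonglongrightarrow> norm (flow t x - x)"
    by (intro tendsto_intros euler_tendsto assms)
  have "norm (euler k t x - x) \<le> t * norm (op x)" for k
  proof -
    have id_pow: "(id ^^ n) x = x" for n by (induction n) auto
    have "norm (euler k t x - x) \<le> real (2 ^ k) * norm (resolvent (t / 2 ^ k) x - x)"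
      using norm_funpow_diff_le[OF resolvent_clinear resolvent_contraction bounded_clinear_id, of "t / 2 ^ k" "2 ^ k" x]
        assms by (simp add: euler_def id_pow)
    also have "\<dots> \<le> real (2 ^ k) * (t / 2 ^ k * norm (op x))"
      using assms by (intro mult_left_mono resolvent_near_id) auto
    finally show ?thesis by simp
  qed
  then show "\<exists>N. \<forall>k\<ge>N. norm (euler k t x - x) \<le> t * norm (op x)" by blast
qed

text \<open>
  A single Euler step approximates the flow, because \<open>euler_diff_bound\<close> is uniform in the number of
  steps, and it approximates \<open>x + t A x\<close> as well, both with error of second order.
\<close>

lemma flow_second_order:
  assumes "0 \<le> t" "x \<in> dom2"
  shows "norm (flow t x - x - t *\<^sub>R op x) \<le> 2 * t\<^sup>2 * norm (op (op x))"
proof -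
  let ?C = "t\<^sup>2 * norm (op (op x))"
  have x: "x \<in> dom A" "op x \<in> dom A" using assms by (auto simp: dom2_def)
  have "norm (flow t x - euler 0 t x) \<le> ?C"
  proof (rule LIMSEQ_le_const2)
    show "(\<lambda>k. norm (euler k t x - euler 0 t x)) \<longlonglongrightarrow> norm (flow t x - euler 0 t x)"
      by (intro tendsto_intros euler_tendsto assms)
    have "norm (euler k t x - euler 0 t x) \<le> ?C" for k
    proof -
      have "norm (euler k t x - euler 0 t x) \<le> ?C * ((1 - (1/2) ^ k) / 2)"
        using euler_diff_bound[OF assms, of 0 k] by simp
      also have "\<dots> \<le> ?C * 1"
      proof (rule mult_left_mono)
        have "(1 - r) / 2 \<le> 1" if "0 \<le> r" for r :: real using that by simp
        from this[of "(1/2) ^ k"] show "(1 - (1/2 :: real) ^ k) / 2 \<le> 1" by (simp only: zero_le_power zero_le_divide_1_iff zero_le_numeral)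
      qed simp
      finally show ?thesis by simp
    qed
    then show "\<exists>N. \<forall>k\<ge>N. norm (euler k t x - euler 0 t x) \<le> ?C" by blast
  qed
  moreover have "norm (resolvent t x - x - t *\<^sub>R op x) \<le> ?C"
  proof -
    have "resolvent t x - x - t *\<^sub>R op x = t *\<^sub>R (resolvent t (op x) - op x)"
      using resolvent_expansion[OF assms(1) x(1)] by (simp add: algebra_simps)
    then have "norm (resolvent t x - x - t *\<^sub>R op x) = t * norm (resolvent t (op x) - op x)"
      using assms by simp
    also have "\<dots> \<le> t * (t * norm (op (op x)))"
      using assms x by (intro mult_left_mono resolvent_near_id) auto
    finally show ?thesis by (simp add: power2_eq_square mult.assoc)
  qed
  moreover have "euler 0 t x = resolvent t x" by (simp add: euler_def)
  moreover have "flow t x - x - t *\<^sub>R op x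
      = (flow t x - resolvent t x) + (resolvent t x - x - t *\<^sub>R op x)" by simp
  ultimately have "norm (flow t x - x - t *\<^sub>R op x) \<le> ?C + ?C"
    by (metis norm_triangle_mono)
  then show ?thesis by simp
qed

lemma contraction_semigroup_flow: "contraction_semigroup flow"
proof -
  have "((\<lambda>t. flow t x) \<longlongrightarrow> x) (at_right 0)" for x
  proof (rule tendsto_on_dense)
    show "closure (dom A) = UNIV" using dense by (simp add: densely_defined_def)
    show "\<forall>\<^sub>F t in at_right 0. \<forall>x y. norm (flow t x - flow t y) \<le> norm (x - y)"
      using eventually_at_right_less by eventually_elim (simp add: flow_diff_le)
    fix x assume x: "x \<in> dom A"
    have "((\<lambda>t. flow t x - x) \<longlongrightarrow> 0) (at_right 0)"
    proof (rule Lim_null_comparison)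
      show "\<forall>\<^sub>F t in at_right 0. norm (flow t x - x) \<le> t * norm (op x)"
        using eventually_at_right_less by eventually_elim (simp add: flow_near_id x)
      show "((\<lambda>t. t * norm (op x)) \<longlongrightarrow> 0) (at_right 0)"
        by (auto intro!: tendsto_eq_intros)
    qed
    then show "((\<lambda>t. flow t x) \<longlongrightarrow> x) (at_right 0)" by (rule LIM_zero_cancel)
  qed
  then show ?thesis
    unfolding contraction_semigroup_def strongly_continuous_semigroup_def
    using flow_clinear flow_contraction flow_add flow_0 by (auto simp: fun_eq_iff)
qed

text \<open>
  On \<open>dom A\<close> the difference quotient is compared with that at \<open>resolvent h x\<close>, a point of the domain
  of \<open>A\<^sup>2\<close> that is close to \<open>x\<close> in the graph norm.
\<close>

lemma difference_quotient_tendsto: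
  assumes x: "x \<in> dom A"
  shows "((\<lambda>t. (flow t x - x) /\<^sub>R t) \<longlongrightarrow> op x) (at_right 0)"
proof (rule tendstoI)
  fix e :: real assume e: "0 < e"
  have "\<forall>\<^sub>F h in at_right 0. dist (resolvent h (op x)) (op x) < e / 4"
    using e by (intro tendstoD[OF resolvent_tendsto]) simp
  then have "\<forall>\<^sub>F h in at_right 0. 0 < h \<and> dist (resolvent h (op x)) (op x) < e / 4"
    using eventually_at_right_less by eventually_elim simp
  then obtain h where h: "0 < h" "dist (resolvent h (op x)) (op x) < e / 4"
    using eventually_happens[of _ "at_right (0::real)"] by auto
  define z where "z = resolvent h x"
  have z: "z \<in> dom A" "op z = resolvent h (op x)" "z \<in> dom2"
    using resolvent_dom[of h x] resolvent(1)[OF h(1)] h x by (auto simp: z_def dom2_def)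
  define \<delta> where "\<delta> = norm (op x - op z)"
  have \<delta>: "\<delta> < e / 4" using h(2) by (simp add: \<delta>_def z dist_norm norm_minus_commute)
  define C where "C = norm (op (op z))"
  have bound: "dist ((flow t x - x) /\<^sub>R t) (op x) \<le> 2 * \<delta> + 2 * t * C" if t: "0 < t" for t
  proof -
    have 1: "norm (flow t (x - z) - (x - z)) \<le> t * \<delta>"
      using flow_near_id[of t "x - z"] t x z by (simp add: \<delta>_def dom_closed op_simps)
    have 2: "norm (flow t z - z - t *\<^sub>R op z) \<le> 2 * t\<^sup>2 * C"
      using flow_second_order[of t z] t z by (simp add: C_def)
    have 3: "norm (t *\<^sub>R (op z - op x)) = t * \<delta>"
      using t by (simp add: \<delta>_def norm_minus_commute)
    have "flow t x - x - t *\<^sub>R op x = (flow t (x - z) - (x - z))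
        + (flow t z - z - t *\<^sub>R op z) + t *\<^sub>R (op z - op x)"
      using t by (simp add: bounded_clinear_simps[OF flow_clinear] algebra_simps)
    then have "norm (flow t x - x - t *\<^sub>R op x) \<le> t * \<delta> + 2 * t\<^sup>2 * C + t * \<delta>"
      using 1 2 3 by (metis (no_types, lifting) norm_triangle_mono order_refl)
    moreover have "flow t x - x - t *\<^sub>R op x = t *\<^sub>R ((flow t x - x) /\<^sub>R t - op x)"
      using t by (simp add: scaleR_diff_right)
    ultimately have "t * norm ((flow t x - x) /\<^sub>R t - op x) \<le> t * (2 * \<delta> + 2 * t * C)"
      using t by (simp add: power2_eq_square distrib_left mult_ac)
    then show ?thesis using t by (simp only: dist_norm mult_le_cancel_left_pos)
  qed
  have "((\<lambda>t. 2 * \<delta> + 2 * t * C) \<longlongrightarrow> 2 * \<delta> + 2 * 0 * C) (at_right 0)"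
    by (intro tendsto_intros)
  moreover have "2 * \<delta> + 2 * 0 * C < e" using \<delta> e by simp
  ultimately have "\<forall>\<^sub>F t in at_right 0. 2 * \<delta> + 2 * t * C < e"
    by (rule order_tendstoD(2))
  then show "\<forall>\<^sub>F t in at_right 0. dist ((flow t x - x) /\<^sub>R t) (op x) < e"
    using eventually_at_right_less
  proof eventually_elim
    case (elim t)
    then show ?case using bound[of t] by linarith
  qed
qed

text \<open>
  The generator extends \<open>A\<close> and is dissipative, hence \<open>1\<close> minus the generator is injective, whereas
  \<open>1 - A\<close> is already onto: there is no room for a proper extension.
\<close>

lemma generator_flow: "generator flow = A"
proof
  fix x
  note quot = difference_quotient_tendsto
  show "generator flow x = A x"
  proof (cases "x \<in> dom A")
    case True
    have "generator flow x = Some (op x)" by (rule generator_eqI) (rule quot[OF True])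
    then show ?thesis using True by force
  next
    case False
    have "generator flow x \<noteq> Some y" for y
    proof
      assume y: "generator flow x = Some y"
      define u where "u = resolvent 1 (x - y)"
      have u: "u \<in> dom A" "u - op u = x - y" using resolvent[of 1 "x - y"] by (simp_all add: u_def)
      have "((\<lambda>t. (flow t x - x) /\<^sub>R t - (flow t u - u) /\<^sub>R t) \<longlongrightarrow> y - op u) (at_right 0)"
        by (intro tendsto_diff generator_tendsto y quot u)
      moreover have "\<forall>\<^sub>F t in at_right 0. (flow t x - x) /\<^sub>R t - (flow t u - u) /\<^sub>R t
          = (flow t (x - u) - (x - u)) /\<^sub>R t"
        using eventually_at_right_less
        by eventually_elim (simp add: bounded_clinear_simps[OF flow_clinear] algebra_simps)
      ultimately have "((\<lambda>t. (flow t (x - u) - (x - u)) /\<^sub>R t) \<longlongrightarrow> y - op u) (at_right 0)"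
        by (rule Lim_transform_eventually)
      then have "generator flow (x - u) = Some (y - op u)" by (rule generator_eqI)
      also have "y - op u = x - u" using u(2) by (simp add: algebra_simps)
      finally have "generator flow (x - u) = Some (x - u)" .
      then have "Re (cinner (x - u) (x - u)) \<le> 0"
        using dissipative_generator[OF contraction_semigroup_flow]
        by (metis dissipative_def domI option.sel)
      then have "x = u" by (simp add: Re_cinner_self)
      then show False using u False by simp
    qed
    then show ?thesis using False by (metis domIff not_Some_eq)
  qed
qed

end

theorem m_dissipative_generates:
  assumes "m_dissipative A"
  shows "generates_contraction_semigroup A"
proof -
  interpret m_dissipative A by (rule assms)
  show ?thesis
    unfolding generates_contraction_semigroup_def
    using contraction_semigroup_flow generator_flow by blast
qed


section \<open>Closed dissipative operators\<close>

text \<open>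
  The bound \<open>\<parallel>x\<parallel> \<le> \<parallel>x - h A x\<parallel>\<close> turns convergence of \<open>x\<^sub>n - h A x\<^sub>n\<close> into convergence of
  \<open>x\<^sub>n\<close>, hence of \<open>A x\<^sub>n\<close>, so that the limit stays in the range.
\<close>

lemma closed_range_dissipative:
  fixes A :: "'a::complex_hilbert \<rightharpoonup> 'a"
  assumes lin: "linear_operator A" and diss: "dissipative A" and cl: "closed_operator A"
    and h: "0 < h"
  shows "closed ((\<lambda>x. x - h *\<^sub>R the (A x)) ` dom A)"
  unfolding closed_sequential_limits
proof (intro allI impI, elim conjE)
  fix y l assume y: "\<forall>n. y n \<in> (\<lambda>x. x - h *\<^sub>R the (A x)) ` dom A" and l: "y \<longlonglongrightarrow> l"
  then obtain x where x: "\<And>n. x n \<in> dom A" "\<And>n. y n = x n - h *\<^sub>R the (A (x n))"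
    unfolding image_iff by metis
  have "dist (x i) (x j) \<le> dist (y i) (y j)" for i j
  proof -
    have minus: "- x j \<in> dom A" "the (A (- x j)) = - the (A (x j))"
      using lin x(1)[of j] unfolding linear_operator_def
      by (metis scaleC_minus_left scaleC_one)+
    have add: "x i + - x j \<in> dom A" "the (A (x i + - x j)) = the (A (x i)) + the (A (- x j))"
      using lin x(1)[of i] minus(1) unfolding linear_operator_def by blast+
    have "norm (x i + - x j) \<le> norm (x i + - x j - h *\<^sub>R the (A (x i + - x j)))"
      using h by (intro dissipative_norm_le[OF diss add(1)]) simp
    also have "x i + - x j - h *\<^sub>R the (A (x i + - x j)) = y i - y j"
      unfolding add(2) minus(2) x(2) by (simp add: algebra_simps)
    finally show ?thesis by (simp add: dist_norm)
  qed
  moreover have "Cauchy y" using l by (rule LIMSEQ_imp_Cauchy)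
  ultimately have "Cauchy x"
    unfolding Cauchy_def by (meson le_less_trans)
  then obtain m where m: "x \<longlonglongrightarrow> m" using Cauchy_convergent convergent_def by blast
  have "(\<lambda>n. (1 / h) *\<^sub>R (x n - y n)) \<longlonglongrightarrow> (1 / h) *\<^sub>R (m - l)"
    by (intro tendsto_intros m l)
  moreover have "(1 / h) *\<^sub>R (x n - y n) = the (A (x n))" for n
    using h by (simp add: x(2))
  ultimately have "(\<lambda>n. the (A (x n))) \<longlonglongrightarrow> (1 / h) *\<^sub>R (m - l)" by simp
  then have lim: "(\<lambda>n. (x n, the (A (x n)))) \<longlonglongrightarrow> (m, (1 / h) *\<^sub>R (m - l))"
    by (rule tendsto_Pair[OF m])
  have "A (x n) = Some (the (A (x n)))" for n
    using x(1)[of n] by force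
  then have "(x n, the (A (x n))) \<in> Map.graph A" for n
    by (rule in_graphI)
  then have "(m, (1 / h) *\<^sub>R (m - l)) \<in> Map.graph A"
    using closed_sequentially[OF cl[unfolded closed_operator_def] _ lim] by blast
  then have "A m = Some ((1 / h) *\<^sub>R (m - l))" by (rule in_graphD)
  then show "l \<in> (\<lambda>x. x - h *\<^sub>R the (A x)) ` dom A"
    using h by (intro image_eqI[of _ _ m]) auto
qed

text \<open>The range of \<open>1 - h A\<close> is a closed subspace, hence everything as soon as only \<open>0\<close> is orthogonal to it.\<close>

lemma m_dissipativeI:
  fixes A :: "'a::complex_hilbert \<rightharpoonup> 'a"
  assumes lin: "linear_operator A" and dense: "densely_defined A"
    and diss: "dissipative A" and cl: "closed_operator A"
    and orth: "\<And>h y. 0 < h \<Longrightarrow> (\<And>x. x \<in> dom A \<Longrightarrow> cinner (x - h *\<^sub>R the (A x)) y = 0) \<Longrightarrow> y = 0"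
  shows "m_dissipative A"
proof
  fix h :: real and y assume h: "0 < h"
  let ?R = "(\<lambda>x. x - h *\<^sub>R the (A x)) ` dom A"
  have lin': "0 \<in> dom A"
    "\<And>x y. x \<in> dom A \<Longrightarrow> y \<in> dom A \<Longrightarrow> x + y \<in> dom A"
    "\<And>x y. x \<in> dom A \<Longrightarrow> y \<in> dom A \<Longrightarrow> the (A (x + y)) = the (A x) + the (A y)"
    "\<And>c x. x \<in> dom A \<Longrightarrow> c *\<^sub>C x \<in> dom A"
    "\<And>c x. x \<in> dom A \<Longrightarrow> the (A (c *\<^sub>C x)) = c *\<^sub>C the (A x)"
    using lin unfolding linear_operator_def by blast+
  have "csubspace ?R"
    unfolding csubspace_def
  proof (intro conjI ballI allI)
    have "the (A 0) = 0" using lin'(5)[OF lin'(1), of 0] by simp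
    then show "0 \<in> ?R" using lin'(1) by (intro image_eqI[of _ _ 0]) auto
  next
    fix u v assume "u \<in> ?R" "v \<in> ?R"
    then obtain a b where ab: "a \<in> dom A" "b \<in> dom A"
      "u = a - h *\<^sub>R the (A a)" "v = b - h *\<^sub>R the (A b)" by blast
    have "u + v = (a + b) - h *\<^sub>R the (A (a + b))"
      unfolding lin'(3)[OF ab(1,2)] ab(3,4) by (simp add: algebra_simps)
    then show "u + v \<in> ?R" using lin'(2)[OF ab(1,2)] by blast
  next
    fix c u assume "u \<in> ?R"
    then obtain a where a: "a \<in> dom A" "u = a - h *\<^sub>R the (A a)" by blast
    have "c *\<^sub>C u = c *\<^sub>C a - h *\<^sub>R the (A (c *\<^sub>C a))"
      unfolding lin'(5)[OF a(1)] a(2) by (simp add: scaleC_diff_right scaleR_scaleC_commute)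
    then show "c *\<^sub>C u \<in> ?R" using lin'(4)[OF a(1)] by blast
  qed
  then have "closure ?R = UNIV"
    by (rule dense_if_orthogonal_trivial) (use orth[OF h] in blast)
  then have "?R = UNIV" using closed_range_dissipative[OF lin diss cl h] by (simp add: closure_closed)
  then show "\<exists>x\<in>dom A. x - h *\<^sub>R the (A x) = y" by (metis (mono_tags, lifting) UNIV_I imageE)
qed (fact lin dense diss)+


section \<open>Adjoints of densely defined operators\<close>

lemma adjoint_operator_eq_Some_iff:
  fixes A :: "'a::complex_inner \<rightharpoonup> 'b::complex_inner"
  assumes "densely_defined A"
  shows "adjoint_operator A y = Some z \<longleftrightarrow> (\<forall>x\<in>dom A. cinner (the (A x)) y = cinner x z)"
proof -
  let ?P = "\<lambda>z. \<forall>x\<in>dom A. cinner (the (A x)) y = cinner x z"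
  have unique: "w = z" if w: "?P w" and z: "?P z" for w z
  proof -
    have "cinner x (w - z) = 0" if "x \<in> dom A" for x
      using w z that by (metis cinner_diff_right diff_self)
    then have "w - z = 0"
      using orthogonal_to_dense_eq_0[of "dom A" "w - z"] assms
      by (simp add: densely_defined_def)
    then show ?thesis by simp
  qed
  have the_eq: "(THE z. ?P z) = z" if "?P z" for z
    using that unique by (intro the_equality) blast+
  show ?thesis
  proof (cases "\<exists>z. ?P z")
    case True
    then obtain w where w: "?P w" by blast
    have "adjoint_operator A y = Some w"
      using True the_eq[OF w] by (simp only: adjoint_operator_def if_True)
    then have "adjoint_operator A y = Some z \<longleftrightarrow> w = z" by simp
    also have "\<dots> \<longleftrightarrow> ?P z" using unique[OF w, of z] w by (intro iffI) simp_all
    finally show ?thesis .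
  next
    case False
    then have "adjoint_operator A y = None" by (simp only: adjoint_operator_def if_False)
    moreover have "\<not> ?P z" using False by (rule contrapos_nn) (rule exI)
    ultimately show ?thesis by (simp only: option.distinct)
  qed
qed

lemma linear_operator_adjoint:
  fixes A :: "'a::complex_inner \<rightharpoonup> 'b::complex_inner"
  assumes "densely_defined A"
  shows "linear_operator (adjoint_operator A)"
proof -
  note iff = adjoint_operator_eq_Some_iff[OF assms]
  have zero: "adjoint_operator A 0 = Some 0" unfolding iff by simp
  have add: "adjoint_operator A (x + y) = Some (u + v)"
    if "adjoint_operator A x = Some u" "adjoint_operator A y = Some v" for x y u v
    using that unfolding iff by (simp add: cinner_add_right)
  have scale: "adjoint_operator A (c *\<^sub>C x) = Some (c *\<^sub>C u)"
    if "adjoint_operator A x = Some u" for c x u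
    using that unfolding iff by (simp add: cinner_scaleC_right)
  show ?thesis
    unfolding linear_operator_def using zero add scale by fastforce
qed

lemma closed_operator_adjoint:
  fixes A :: "'a::complex_inner \<rightharpoonup> 'b::complex_inner"
  assumes "densely_defined A"
  shows "closed_operator (adjoint_operator A)"
proof -
  have cont: "continuous_on UNIV (\<lambda>p :: 'b \<times> 'a. cinner u (f p))"
    if "continuous_on UNIV f" for u :: "'c::complex_inner" and f :: "'b \<times> 'a \<Rightarrow> 'c"
    using that unfolding continuous_on_def by (auto intro: tendsto_cinner tendsto_const)
  have "p \<in> Map.graph (adjoint_operator A)
      \<longleftrightarrow> (\<forall>x\<in>dom A. cinner (the (A x)) (fst p) = cinner x (snd p))" for p
    unfolding adjoint_operator_eq_Some_iff[OF assms, symmetric]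
    by (cases p) (auto intro: in_graphI dest: in_graphD)
  then have "Map.graph (adjoint_operator A)
      = (\<Inter>x\<in>dom A. {p. cinner (the (A x)) (fst p) = cinner x (snd p)})"
    by (intro set_eqI) (simp only: INT_iff mem_Collect_eq)
  then show ?thesis
    unfolding closed_operator_def
    by (simp only:) (intro closed_INT ballI closed_Collect_eq cont continuous_intros)
qed

text \<open>
  Polarization: the vanishing of \<open>Re \<langle>z, A z\<rangle>\<close> at \<open>z = x + y\<close> annihilates the real part of the sum,
  and at \<open>z = x + \<i> y\<close> the imaginary part.
\<close>

lemma skew_symmetric_cinner:
  fixes A :: "'a::complex_inner \<rightharpoonup> 'a"
  assumes lin: "linear_operator A" and skew: "skew_symmetric A" and x: "x \<in> dom A" and y: "y \<in> dom A"
  shows "cinner (the (A x)) y + cinner x (the (A y)) = 0"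
proof -
  have Re0: "Re (cinner (the (A x)) y + cinner x (the (A y))) = 0" if y: "y \<in> dom A" for y
  proof -
    have xy: "x + y \<in> dom A" "the (A (x + y)) = the (A x) + the (A y)"
      using lin x y unfolding linear_operator_def by blast+
    have "Re (cinner z (the (A z))) = 0" if "z \<in> dom A" for z
      using skew that unfolding skew_symmetric_def by blast
    from this[OF x] this[OF y] this[OF xy(1)] show ?thesis
      unfolding xy(2) using Re_cinner_commute[of y "the (A x)"]
      by (simp add: cinner_add_left cinner_add_right)
  qed
  have iy: "\<i> *\<^sub>C y \<in> dom A" "the (A (\<i> *\<^sub>C y)) = \<i> *\<^sub>C the (A y)"
    using lin y unfolding linear_operator_def by blast+
  have "Im (cinner (the (A x)) y + cinner x (the (A y))) = 0"
    using Re0[OF iy(1)] unfolding iy(2) by (simp add: cinner_scaleC_right)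
  then show ?thesis using Re0[OF y] by (simp add: complex_eq_iff)
qed


section \<open>The boundary condition\<close>

text \<open>
  For \<open>S\<close> injective and \<open>range D \<subseteq> range S\<close> the relation \<open>S p + D q = 0\<close> is the graph of the map
  \<open>q \<mapsto> - S\<^sup>-\<^sup>1 D q\<close>. If it is contractive, then with \<open>q = D\<^sup>* k\<close> one gets
  \<open>\<parallel>D\<^sup>* k\<parallel>\<^sup>2 = \<langle>D q, k\<rangle> = - \<langle>p, S\<^sup>* k\<rangle> \<le> \<parallel>D\<^sup>* k\<parallel> \<parallel>S\<^sup>* k\<parallel>\<close>. Conversely,
  \<open>\<bar>\<langle>p, S\<^sup>* k\<rangle>\<bar> = \<bar>\<langle>q, D\<^sup>* k\<rangle>\<bar> \<le> \<parallel>q\<parallel> \<parallel>S\<^sup>* k\<parallel>\<close> for all \<open>k\<close>, and the vectors \<open>S\<^sup>* k\<close> come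
  arbitrarily close to \<open>p\<close>.
\<close>

lemma contractive_relation_iff:
  fixes S D :: "'b::complex_hilbert \<Rightarrow> 'k::complex_hilbert"
  assumes S: "bounded_clinear S" and D: "bounded_clinear D" and ran: "range D \<subseteq> range S"
  shows "(\<forall>p q. S p + D q = 0 \<longrightarrow> norm p \<le> norm q) \<longleftrightarrow>
    inj S \<and> (\<forall>k. norm (cadjoint D k) \<le> norm (cadjoint S k))"
proof (intro iffI conjI allI impI)
  assume contr: "\<forall>p q. S p + D q = 0 \<longrightarrow> norm p \<le> norm q"
  show "inj S"
  proof (rule injI)
    fix x y assume "S x = S y"
    then have "S (x - y) + D 0 = 0"
      by (simp add: bounded_clinear_simps[OF S] bounded_clinear_simps[OF D])
    then have "norm (x - y) \<le> norm (0::'b)" using contr by blast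
    then show "x = y" by simp
  qed
  fix k
  let ?d = "cadjoint D k" and ?s = "cadjoint S k"
  obtain p where "D (- ?d) = S p" using ran by blast
  then have Sp: "S p + D ?d = 0" by (metis add.commute bounded_clinear_simps(3)[OF D] neg_eq_iff_add_eq_0 add.inverse_inverse)
  then have p: "norm p \<le> norm ?d" using contr by blast
  have "complex_of_real ((norm ?d)\<^sup>2) = cinner (D ?d) k"
    by (simp add: cinner_cadjoint[OF D] cinner_self)
  also have "\<dots> = - cinner (S p) k"
    using Sp by (metis add_eq_0_iff2 add.commute cinner_minus_left)
  also have "\<dots> = - cinner p ?s" by (simp add: cinner_cadjoint[OF S])
  finally have "(norm ?d)\<^sup>2 = cmod (cinner p ?s)"
    by (metis abs_of_nonneg norm_minus_cancel norm_of_real zero_le_power2)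
  also have "\<dots> \<le> norm ?d * norm ?s"
    using cinner_Cauchy_Schwarz[of p ?s] p by (meson mult_right_mono norm_ge_zero order_trans)
  finally have "norm ?d * norm ?d \<le> norm ?d * norm ?s" by (simp add: power2_eq_square)
  then show "norm ?d \<le> norm ?s" by (cases "?d = 0") (simp_all)
next
  fix p q
  assume "inj S \<and> (\<forall>k. norm (cadjoint D k) \<le> norm (cadjoint S k))" and Sp: "S p + D q = 0"
  then have inj: "inj S" and le: "\<And>k. norm (cadjoint D k) \<le> norm (cadjoint S k)" by blast+
  obtain s where s: "\<And>n. s n \<in> range (cadjoint S)" "s \<longlonglongrightarrow> p"
    using range_cadjoint_dense[OF S inj] closure_sequential[of p "range (cadjoint S)"] by auto
  have "cmod (cinner p (s n)) \<le> norm q * norm (s n)" for n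
  proof -
    obtain k where k: "s n = cadjoint S k" using s(1)[of n] by blast
    have "cinner p (s n) = cinner (S p) k" by (simp add: k cinner_cadjoint[OF S])
    also have "S p = - D q" using Sp by (simp add: eq_neg_iff_add_eq_0)
    also have "cinner (- D q) k = - cinner q (cadjoint D k)"
      by (simp add: cinner_minus_left cinner_cadjoint[OF D])
    finally have "cmod (cinner p (s n)) \<le> norm q * norm (cadjoint D k)"
      using cinner_Cauchy_Schwarz[of q "cadjoint D k"] by simp
    also have "\<dots> \<le> norm q * norm (s n)" using le[of k] by (simp add: k mult_left_mono)
    finally show ?thesis .
  qed
  moreover have "(\<lambda>n. cmod (cinner p (s n))) \<longlonglongrightarrow> cmod (cinner p p)"
    "(\<lambda>n. norm q * norm (s n)) \<longlonglongrightarrow> norm q * norm p"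
    by (intro tendsto_intros s)+
  ultimately have "cmod (cinner p p) \<le> norm q * norm p"
    by (intro LIMSEQ_le) auto
  moreover have "cmod (cinner p p) = norm p * norm p"
    unfolding cinner_self norm_of_real by (simp add: power2_eq_square)
  ultimately have "norm p * norm p \<le> norm q * norm p" by simp
  then show "norm p \<le> norm q" by (cases "p = 0") simp_all
qed

text \<open>
  With \<open>a = W\<^sub>1\<^sup>* k\<close> and \<open>b = W\<^sub>2\<^sup>* k\<close> the quadratic form of \<open>W\<^sub>1 W\<^sub>2\<^sup>* + W\<^sub>2 W\<^sub>1\<^sup>*\<close> at \<open>k\<close> is
  \<open>2 Re \<langle>a, b\<rangle> = (\<parallel>a + b\<parallel>\<^sup>2 - \<parallel>a - b\<parallel>\<^sup>2) / 2\<close>.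
\<close>

lemma nonneg_operator_iff:
  fixes W\<^sub>1 W\<^sub>2 :: "'b::complex_hilbert \<Rightarrow> 'k::complex_hilbert"
  assumes W: "bounded_clinear W\<^sub>1" "bounded_clinear W\<^sub>2"
    and S: "bounded_clinear (\<lambda>f. W\<^sub>1 f + W\<^sub>2 f)" and D: "bounded_clinear (\<lambda>f. W\<^sub>1 f - W\<^sub>2 f)"
  shows "nonneg_operator (\<lambda>k. W\<^sub>1 (cadjoint W\<^sub>2 k) + W\<^sub>2 (cadjoint W\<^sub>1 k)) \<longleftrightarrow>
    (\<forall>k. norm (cadjoint (\<lambda>f. W\<^sub>1 f - W\<^sub>2 f) k) \<le> norm (cadjoint (\<lambda>f. W\<^sub>1 f + W\<^sub>2 f) k))"
proof -
  have "cinner k (W\<^sub>1 (cadjoint W\<^sub>2 k) + W\<^sub>2 (cadjoint W\<^sub>1 k)) \<in> \<real>\<^sub>\<ge>\<^sub>0 \<longleftrightarrow>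
    norm (cadjoint (\<lambda>f. W\<^sub>1 f - W\<^sub>2 f) k) \<le> norm (cadjoint (\<lambda>f. W\<^sub>1 f + W\<^sub>2 f) k)" for k
  proof -
    let ?a = "cadjoint W\<^sub>1 k" and ?b = "cadjoint W\<^sub>2 k"
    have sum: "cadjoint (\<lambda>f. W\<^sub>1 f + W\<^sub>2 f) k = ?a + ?b"
      by (rule cadjoint_eqI[OF S])
        (simp add: cinner_add_left cinner_add_right cinner_cadjoint[OF W(1)] cinner_cadjoint[OF W(2)])
    have diff: "cadjoint (\<lambda>f. W\<^sub>1 f - W\<^sub>2 f) k = ?a - ?b"
      by (rule cadjoint_eqI[OF D])
        (simp add: cinner_diff_left cinner_diff_right cinner_cadjoint[OF W(1)] cinner_cadjoint[OF W(2)])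
    have "cinner k (W\<^sub>1 ?b + W\<^sub>2 ?a) = cnj (cinner (W\<^sub>1 ?b) k) + cnj (cinner (W\<^sub>2 ?a) k)"
      by (metis cinner_add_right cinner_commute)
    also have "\<dots> = cinner ?a ?b + cnj (cinner ?a ?b)"
      by (metis cinner_cadjoint[OF W(1)] cinner_cadjoint[OF W(2)] cinner_commute)
    also have "\<dots> = complex_of_real (2 * Re (cinner ?a ?b))"
      by (rule complex_add_cnj)
    finally have "cinner k (W\<^sub>1 ?b + W\<^sub>2 ?a) \<in> \<real>\<^sub>\<ge>\<^sub>0 \<longleftrightarrow> 0 \<le> Re (cinner ?a ?b)"
      by (simp only: complex_nonneg_Reals_iff Re_complex_of_real Im_complex_of_real) simp
    also have "\<dots> \<longleftrightarrow> (norm (?a - ?b))\<^sup>2 \<le> (norm (?a + ?b))\<^sup>2"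
      unfolding norm_add_sq norm_diff_sq by simp
    also have "\<dots> \<longleftrightarrow> norm (?a - ?b) \<le> norm (?a + ?b)"
      by (simp add: abs_le_square_iff[symmetric])
    finally show ?thesis by (simp only: sum diff)
  qed
  then show ?thesis unfolding nonneg_operator_def by blast
qed

text \<open>
  In the coordinates \<open>p = f + e\<close>, \<open>q = f - e\<close> of the boundary space the boundary form
  \<open>\<langle>f, e\<rangle> + \<langle>e, f\<rangle>\<close> is diagonal.
\<close>

lemma cinner_boundary_form:
  fixes f e f' e' :: "'b::complex_inner"
  shows "2 * (cinner f e' + cinner e f') = cinner (f + e) (f' + e') - cinner (f - e) (f' - e')"
  by (simp add: cinner_add_left cinner_add_right cinner_diff_left cinner_diff_right)

locale Green_triplet =
  fixes A\<^sub>0 :: "'x::complex_hilbert \<rightharpoonup> 'x" and B\<^sub>1 B\<^sub>2 :: "'x \<Rightarrow> 'b::complex_hilbert"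
  assumes triplet: "boundary_triplet A\<^sub>0 B\<^sub>1 B\<^sub>2"
begin

abbreviation Astar :: "'x \<rightharpoonup> 'x" where "Astar \<equiv> adjoint_operator A\<^sub>0"

lemma A0:
  "linear_operator A\<^sub>0" "densely_defined A\<^sub>0" "skew_symmetric A\<^sub>0"
  using triplet by (auto simp: boundary_triplet_def)

lemma boundary_surj: "\<exists>x\<in>dom Astar. B\<^sub>1 x = f \<and> B\<^sub>2 x = e"
proof -
  have "(f, e) \<in> (\<lambda>x. (B\<^sub>1 x, B\<^sub>2 x)) ` dom Astar"
    using triplet by (simp add: boundary_triplet_def)
  then show ?thesis by blast
qed

lemma Green:
  assumes "x \<in> dom Astar" "y \<in> dom Astar"
  shows "cinner (the (Astar x)) y + cinner x (the (Astar y))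
    = cinner (B\<^sub>1 x) (B\<^sub>2 y) + cinner (B\<^sub>2 x) (B\<^sub>1 y)"
  using triplet assms unfolding boundary_triplet_def by blast

lemma Re_cinner_Astar:
  assumes "x \<in> dom Astar"
  shows "4 * Re (cinner x (the (Astar x))) = (norm (B\<^sub>1 x + B\<^sub>2 x))\<^sup>2 - (norm (B\<^sub>1 x - B\<^sub>2 x))\<^sup>2"
proof -
  have "Re (cinner x (the (Astar x))) = Re (cinner (B\<^sub>1 x) (B\<^sub>2 x))"
    using arg_cong[OF Green[OF assms assms], of Re]
      Re_cinner_commute[of "the (Astar x)" x] Re_cinner_commute[of "B\<^sub>2 x" "B\<^sub>1 x"] by simp
  then show ?thesis by (simp add: norm_add_sq norm_diff_sq)
qed

lemma Astar_linear:
  "0 \<in> dom Astar"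
  "x \<in> dom Astar \<Longrightarrow> y \<in> dom Astar \<Longrightarrow> x + y \<in> dom Astar"
  "x \<in> dom Astar \<Longrightarrow> y \<in> dom Astar \<Longrightarrow> the (Astar (x + y)) = the (Astar x) + the (Astar y)"
  "x \<in> dom Astar \<Longrightarrow> c *\<^sub>C x \<in> dom Astar"
  "x \<in> dom Astar \<Longrightarrow> the (Astar (c *\<^sub>C x)) = c *\<^sub>C the (Astar x)"
  using linear_operator_adjoint[OF A0(2)] unfolding linear_operator_def by blast+

lemma B_linear:
  "x \<in> dom Astar \<Longrightarrow> y \<in> dom Astar \<Longrightarrow> B\<^sub>1 (x + y) = B\<^sub>1 x + B\<^sub>1 y"
  "x \<in> dom Astar \<Longrightarrow> y \<in> dom Astar \<Longrightarrow> B\<^sub>2 (x + y) = B\<^sub>2 x + B\<^sub>2 y"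
  "x \<in> dom Astar \<Longrightarrow> B\<^sub>1 (c *\<^sub>C x) = c *\<^sub>C B\<^sub>1 x"
  "x \<in> dom Astar \<Longrightarrow> B\<^sub>2 (c *\<^sub>C x) = c *\<^sub>C B\<^sub>2 x"
  using triplet unfolding boundary_triplet_def graph_bounded_clinear_def by blast+

text \<open>
  Skew-symmetry makes \<open>A\<^sub>0\<^sup>*\<close> an extension of \<open>- A\<^sub>0\<close>, so Green's identity pairs the boundary values
  of \<open>x \<in> dom A\<^sub>0\<close> to \<open>0\<close> with all boundary values.
\<close>

lemma A0_in_Astar:
  assumes x: "x \<in> dom A\<^sub>0"
  shows "Astar x = Some (- the (A\<^sub>0 x))" "B\<^sub>1 x = 0" "B\<^sub>2 x = 0"
proof -
  show Ax: "Astar x = Some (- the (A\<^sub>0 x))"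
    unfolding adjoint_operator_eq_Some_iff[OF A0(2)]
    using skew_symmetric_cinner[OF A0(1,3) _ x] by (simp add: cinner_minus_right eq_neg_iff_add_eq_0)
  then have xd: "x \<in> dom Astar" by blast
  have pair0: "cinner (B\<^sub>1 x) (B\<^sub>2 y) + cinner (B\<^sub>2 x) (B\<^sub>1 y) = 0" if y: "y \<in> dom Astar" for y
  proof -
    have "Astar y = Some (the (Astar y))" using y by force
    then have "cinner (the (A\<^sub>0 x)) y = cinner x (the (Astar y))"
      using x unfolding adjoint_operator_eq_Some_iff[OF A0(2)] by blast
    then show ?thesis using Green[OF xd y] Ax by (simp add: cinner_minus_left)
  qed
  \<comment> \<open>with the two boundary values of \<open>x\<close> interchanged the pairing becomes the sum of their squared norms\<close>
  obtain y where "y \<in> dom Astar" "B\<^sub>1 y = B\<^sub>2 x" "B\<^sub>2 y = B\<^sub>1 x" using boundary_surj by blast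
  with pair0[of y] have "Re (cinner (B\<^sub>1 x) (B\<^sub>1 x) + cinner (B\<^sub>2 x) (B\<^sub>2 x)) = 0" by simp
  then have "(norm (B\<^sub>1 x))\<^sup>2 + (norm (B\<^sub>2 x))\<^sup>2 = 0" by (simp add: Re_cinner_self)
  then show "B\<^sub>1 x = 0" "B\<^sub>2 x = 0" by (simp_all add: add_nonneg_eq_0_iff)
qed

lemma B_tendsto:
  assumes B: "graph_bounded_clinear Astar B" and u: "\<And>n. u n \<in> dom Astar" and x: "x \<in> dom Astar"
    and lim: "u \<longlonglongrightarrow> x" "(\<lambda>n. the (Astar (u n))) \<longlonglongrightarrow> the (Astar x)"
  shows "(\<lambda>n. B (u n)) \<longlonglongrightarrow> B x"
proof -
  obtain M where M: "\<And>x. x \<in> dom Astar \<Longrightarrow> norm (B x) \<le> M * graph_norm Astar x"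
    using B unfolding graph_bounded_clinear_def by blast
  have B_add: "\<And>x y. x \<in> dom Astar \<Longrightarrow> y \<in> dom Astar \<Longrightarrow> B (x + y) = B x + B y"
    and B_scale: "\<And>c x. x \<in> dom Astar \<Longrightarrow> B (c *\<^sub>C x) = c *\<^sub>C B x"
    using B unfolding graph_bounded_clinear_def by blast+
  have mx: "- x \<in> dom Astar" "the (Astar (- x)) = - the (Astar x)" "B (- x) = - B x"
    using Astar_linear(4,5)[OF x, of "- 1"] B_scale[OF x, of "- 1"]
    by (simp_all only: scaleC_minus_left scaleC_one)
  define g where "g n = M * sqrt ((norm (u n - x))\<^sup>2 + (norm (the (Astar (u n)) - the (Astar x)))\<^sup>2)" for n
  have bound: "norm (B (u n) - B x) \<le> g n" for n
    using M[OF Astar_linear(2)[OF u mx(1)], of n]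
    unfolding graph_norm_def B_add[OF u mx(1)] Astar_linear(3)[OF u mx(1)] mx(2,3) g_def
    by (simp only: add_uminus_conv_diff)
  have "g \<longlonglongrightarrow> M * sqrt ((norm (x - x))\<^sup>2 + (norm (the (Astar x) - the (Astar x)))\<^sup>2)"
    unfolding g_def by (intro tendsto_intros lim)
  then have "g \<longlonglongrightarrow> 0" by simp
  moreover have "\<forall>\<^sub>F n in sequentially. norm (B (u n) - B x) \<le> g n"
    by (intro always_eventually allI bound)
  ultimately have "(\<lambda>n. B (u n) - B x) \<longlonglongrightarrow> 0" by (rule Lim_null_comparison[rotated])
  then show ?thesis by (rule LIM_zero_cancel)
qed

end

locale boundary_condition = Green_triplet A\<^sub>0 B\<^sub>1 B\<^sub>2
  for A\<^sub>0 :: "'x::complex_hilbert \<rightharpoonup> 'x" and B\<^sub>1 B\<^sub>2 :: "'x \<Rightarrow> 'b::complex_hilbert" +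
  fixes W\<^sub>1 W\<^sub>2 :: "'b \<Rightarrow> 'k::complex_hilbert"
  assumes W: "bounded_clinear W\<^sub>1" "bounded_clinear W\<^sub>2"
begin

definition A :: "'x \<rightharpoonup> 'x" where
  "A = Astar |` {x \<in> dom Astar. W\<^sub>1 (B\<^sub>1 x) + W\<^sub>2 (B\<^sub>2 x) = 0}"

definition S :: "'b \<Rightarrow> 'k" where "S f = W\<^sub>1 f + W\<^sub>2 f"
definition D :: "'b \<Rightarrow> 'k" where "D f = W\<^sub>1 f - W\<^sub>2 f"

lemma S_D_clinear: "bounded_clinear S" "bounded_clinear D"
  unfolding S_def D_def using W
  by (auto simp: bounded_clinear_def scaleC_add_right scaleC_diff_right
      intro!: bounded_linear_add bounded_linear_sub)

lemma A_eq_Some_iff: "A x = Some z \<longleftrightarrow> Astar x = Some z \<and> W\<^sub>1 (B\<^sub>1 x) + W\<^sub>2 (B\<^sub>2 x) = 0"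
  by (auto simp: A_def restrict_map_def)

lemma boundary_condition_iff:
  "W\<^sub>1 f + W\<^sub>2 e = 0 \<longleftrightarrow> S (f + e) + D (f - e) = 0"
proof -
  have "S (f + e) + D (f - e) = 2 *\<^sub>R (W\<^sub>1 f + W\<^sub>2 e)"
    by (simp add: S_def D_def bounded_clinear_simps[OF W(1)] bounded_clinear_simps[OF W(2)] scaleR_2)
  then show ?thesis by simp
qed

lemma dom_A_iff: "x \<in> dom A \<longleftrightarrow> x \<in> dom Astar \<and> S (B\<^sub>1 x + B\<^sub>2 x) + D (B\<^sub>1 x - B\<^sub>2 x) = 0"
  unfolding boundary_condition_iff[symmetric] by (auto simp: dom_def A_eq_Some_iff)

lemma A_eq: "x \<in> dom A \<Longrightarrow> A x = Astar x"
  by (force simp: dom_def A_eq_Some_iff)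

lemma dom_A_boundary_surj:
  assumes "S p + D q = 0"
  obtains x where "x \<in> dom A" "B\<^sub>1 x + B\<^sub>2 x = p" "B\<^sub>1 x - B\<^sub>2 x = q"
proof -
  obtain x where x: "x \<in> dom Astar" "B\<^sub>1 x = (1/2) *\<^sub>R (p + q)" "B\<^sub>2 x = (1/2) *\<^sub>R (p - q)"
    using boundary_surj by blast
  have half: "(1/2) *\<^sub>R z + (1/2) *\<^sub>R z = z" for z :: 'b
    by (simp flip: scaleR_add_left)
  have "B\<^sub>1 x + B\<^sub>2 x = p" "B\<^sub>1 x - B\<^sub>2 x = q"
    using half[of p] half[of q] by (simp_all add: x algebra_simps)
  then show ?thesis using that[of x] x(1) assms by (simp add: dom_A_iff)
qed

text \<open>
  Every pair subject to the boundary condition occurs as boundary values, so that dissipativity is a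
  property of \<open>S\<close> and \<open>D\<close> alone.
\<close>

lemma dissipative_iff: "dissipative A \<longleftrightarrow> (\<forall>p q. S p + D q = 0 \<longrightarrow> norm p \<le> norm q)"
proof -
  have Re_iff: "Re (cinner x (the (A x))) \<le> 0 \<longleftrightarrow> norm (B\<^sub>1 x + B\<^sub>2 x) \<le> norm (B\<^sub>1 x - B\<^sub>2 x)"
    if "x \<in> dom A" for x
  proof -
    have "4 * Re (cinner x (the (A x))) = (norm (B\<^sub>1 x + B\<^sub>2 x))\<^sup>2 - (norm (B\<^sub>1 x - B\<^sub>2 x))\<^sup>2"
      using Re_cinner_Astar that by (simp add: A_eq dom_A_iff)
    then have "Re (cinner x (the (A x))) \<le> 0
        \<longleftrightarrow> (norm (B\<^sub>1 x + B\<^sub>2 x))\<^sup>2 \<le> (norm (B\<^sub>1 x - B\<^sub>2 x))\<^sup>2" by linarith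
    then show ?thesis by (simp add: abs_le_square_iff[symmetric])
  qed
  show ?thesis
    unfolding dissipative_def
    by (metis Re_iff dom_A_boundary_surj dom_A_iff)
qed

lemma linear_operator_A: "linear_operator A"
proof -
  note W_simps = bounded_clinear_simps[OF W(1)] bounded_clinear_simps[OF W(2)]
  have B0: "B\<^sub>1 0 = 0" "B\<^sub>2 0 = 0" using B_linear(3,4)[OF Astar_linear(1), of 0] by simp_all
  have iff: "x \<in> dom A \<longleftrightarrow> x \<in> dom Astar \<and> W\<^sub>1 (B\<^sub>1 x) + W\<^sub>2 (B\<^sub>2 x) = 0" for x
    by (auto simp: dom_def A_eq_Some_iff)
  have zero: "0 \<in> dom A" using Astar_linear(1) by (simp add: iff B0 W_simps)
  have add: "x + y \<in> dom A" if "x \<in> dom A" "y \<in> dom A" for x y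
  proof -
    have "W\<^sub>1 (B\<^sub>1 (x + y)) + W\<^sub>2 (B\<^sub>2 (x + y))
        = (W\<^sub>1 (B\<^sub>1 x) + W\<^sub>2 (B\<^sub>2 x)) + (W\<^sub>1 (B\<^sub>1 y) + W\<^sub>2 (B\<^sub>2 y))"
      using that unfolding iff by (simp only: B_linear W_simps) (simp add: algebra_simps)
    then show ?thesis using that Astar_linear(2) unfolding iff by simp
  qed
  have scale: "c *\<^sub>C x \<in> dom A" if "x \<in> dom A" for c x
  proof -
    have "W\<^sub>1 (B\<^sub>1 (c *\<^sub>C x)) + W\<^sub>2 (B\<^sub>2 (c *\<^sub>C x)) = c *\<^sub>C (W\<^sub>1 (B\<^sub>1 x) + W\<^sub>2 (B\<^sub>2 x))"
      using that unfolding iff by (simp add: B_linear W_simps flip: scaleC_add_right)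
    then show ?thesis using that Astar_linear(4) unfolding iff by simp
  qed
  have sub: "x \<in> dom Astar" if "x \<in> dom A" for x using that unfolding iff by blast
  show ?thesis
    unfolding linear_operator_def
  proof (intro conjI ballI allI)
    fix x y assume xy: "x \<in> dom A" "y \<in> dom A"
    show "the (A (x + y)) = the (A x) + the (A y)"
      by (simp only: A_eq add xy Astar_linear(3) sub)
  next
    fix c x assume x: "x \<in> dom A"
    show "the (A (c *\<^sub>C x)) = c *\<^sub>C the (A x)"
      by (simp only: A_eq scale x Astar_linear(5) sub)
  qed (fact zero add scale)+
qed

text \<open>The graph of \<open>A\<^sub>0\<^sup>*\<close> is closed, and the boundary condition survives limits in it because the boundary
  operators are bounded in the graph norm.\<close>

lemma closed_operator_A: "closed_operator A"
  unfolding closed_operator_def closed_sequential_limits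
proof (intro allI impI, elim conjE)
  fix w l assume w: "\<forall>n. w n \<in> Map.graph A" and l: "w \<longlonglongrightarrow> l"
  define u z where "u n = fst (w n)" and "z n = snd (w n)" for n
  obtain x y where xy: "l = (x, y)" by fastforce
  have "u \<longlonglongrightarrow> x" "z \<longlonglongrightarrow> y"
    using tendsto_fst[OF l] tendsto_snd[OF l] by (simp_all add: u_def[abs_def] z_def[abs_def] xy)
  have "A (u n) = Some (z n)" for n
    using w by (intro in_graphD) (simp add: u_def z_def)
  then have u: "Astar (u n) = Some (z n)" "W\<^sub>1 (B\<^sub>1 (u n)) + W\<^sub>2 (B\<^sub>2 (u n)) = 0" for n
    unfolding A_eq_Some_iff by blast+
  have "(u n, z n) \<in> Map.graph Astar" for n by (rule in_graphI) (rule u(1))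
  then have "w n \<in> Map.graph Astar" for n by (simp add: u_def z_def)
  then have "l \<in> Map.graph Astar"
    using closed_sequentially[OF closed_operator_adjoint[OF A0(2), unfolded closed_operator_def] _ l]
    by blast
  then have x: "Astar x = Some y" unfolding xy by (rule in_graphD)
  have "(\<lambda>n. B (u n)) \<longlonglongrightarrow> B x" if "graph_bounded_clinear Astar B" for B :: "'x \<Rightarrow> 'b"
  proof (rule B_tendsto[OF that])
    show "u n \<in> dom Astar" for n by (rule domI) (rule u(1))
    show "x \<in> dom Astar" by (rule domI) (rule x)
    show "(\<lambda>n. the (Astar (u n))) \<longlonglongrightarrow> the (Astar x)"
      unfolding u(1) x option.sel by (rule \<open>z \<longlonglongrightarrow> y\<close>)
  qed (rule \<open>u \<longlonglongrightarrow> x\<close>)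
  then have "(\<lambda>n. B\<^sub>1 (u n)) \<longlonglongrightarrow> B\<^sub>1 x" "(\<lambda>n. B\<^sub>2 (u n)) \<longlonglongrightarrow> B\<^sub>2 x"
    using triplet unfolding boundary_triplet_def by blast+
  note B_lim = this
  have "bounded_linear W\<^sub>1" "bounded_linear W\<^sub>2" using W by (simp_all add: bounded_clinear_def)
  from tendsto_add[OF bounded_linear.tendsto[OF this(1) B_lim(1)] bounded_linear.tendsto[OF this(2) B_lim(2)]]
  have "(\<lambda>n. W\<^sub>1 (B\<^sub>1 (u n)) + W\<^sub>2 (B\<^sub>2 (u n))) \<longlonglongrightarrow> W\<^sub>1 (B\<^sub>1 x) + W\<^sub>2 (B\<^sub>2 x)" .
  then have "W\<^sub>1 (B\<^sub>1 x) + W\<^sub>2 (B\<^sub>2 x) = 0" unfolding u(2) by (simp add: LIMSEQ_const_iff)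
  then have "A x = Some y" using x by (simp add: A_eq_Some_iff)
  then show "l \<in> Map.graph A" unfolding xy by (rule in_graphI)
qed

lemma A0_sub_A:
  assumes "x \<in> dom A\<^sub>0"
  shows "A x = Some (- the (A\<^sub>0 x))"
  using A0_in_Astar[OF assms]
  by (simp add: A_eq_Some_iff bounded_clinear_simps[OF W(1)] bounded_clinear_simps[OF W(2)])

lemma densely_defined_A: "densely_defined A"
proof -
  have "dom A\<^sub>0 \<subseteq> dom A" using A0_sub_A by blast
  then have "closure (dom A\<^sub>0) \<subseteq> closure (dom A)" by (rule closure_mono)
  then show ?thesis using A0(2) by (auto simp: densely_defined_def)
qed

text \<open>
  A vector \<open>y\<close> orthogonal to the range of \<open>1 - h A\<close> solves \<open>h A\<^sub>0\<^sup>* y = - y\<close>. Testing with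
  \<open>x \<in> dom A\<close> whose second boundary coordinate equals that of \<open>y\<close> shows that the boundary values of
  \<open>y\<close> satisfy the reversed contraction estimate, so \<open>Re \<langle>y, A\<^sub>0\<^sup>* y\<rangle> \<ge> 0\<close> and \<open>y = 0\<close>.
\<close>

lemma m_dissipative_A:
  assumes ran: "range D \<subseteq> range S" and diss: "dissipative A"
  shows "m_dissipative A"
proof (rule m_dissipativeI[OF linear_operator_A densely_defined_A diss closed_operator_A])
  fix h :: real and y
  assume h: "0 < h" and orth: "\<And>x. x \<in> dom A \<Longrightarrow> cinner (x - h *\<^sub>R the (A x)) y = 0"
  have contr: "norm p \<le> norm q" if "S p + D q = 0" for p q
    using diss that unfolding dissipative_iff by blast
  define v where "v = (1 / h) *\<^sub>R y"
  have Ax_y: "cinner (the (A x)) y = cinner x v" if "x \<in> dom A" for x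
    using orth[OF that] h by (simp add: v_def cinner_diff_left cinner_scaleR_left cinner_scaleR_right)
  have "Astar y = Some (- v)"
    unfolding adjoint_operator_eq_Some_iff[OF A0(2)]
  proof
    fix x assume "x \<in> dom A\<^sub>0"
    then have Ax: "A x = Some (- the (A\<^sub>0 x))" by (rule A0_sub_A)
    then have "cinner (- the (A\<^sub>0 x)) y = cinner x v" using Ax_y[of x] by force
    then show "cinner (the (A\<^sub>0 x)) y = cinner x (- v)"
      by (simp add: cinner_minus_left cinner_minus_right minus_equation_iff)
  qed
  then have y: "y \<in> dom Astar" "the (Astar y) = - v" by auto
  define py qy where "py = B\<^sub>1 y + B\<^sub>2 y" and "qy = B\<^sub>1 y - B\<^sub>2 y"
  have pair: "cinner p py = cinner q qy" if pq: "S p + D q = 0" for p q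
  proof -
    obtain x where x: "x \<in> dom A" "B\<^sub>1 x + B\<^sub>2 x = p" "B\<^sub>1 x - B\<^sub>2 x = q"
      using dom_A_boundary_surj[OF pq] .
    have "cinner (the (Astar x)) y + cinner x (the (Astar y)) = 0"
      using Ax_y[OF x(1)] A_eq[OF x(1)] by (simp add: y(2) cinner_minus_right)
    then have "cinner (B\<^sub>1 x) (B\<^sub>2 y) + cinner (B\<^sub>2 x) (B\<^sub>1 y) = 0"
      using Green y(1) x(1) dom_A_iff by simp
    then show ?thesis
      using cinner_boundary_form[of "B\<^sub>1 x" "B\<^sub>2 y" "B\<^sub>2 x" "B\<^sub>1 y"] x(2,3)
      by (simp add: py_def qy_def)
  qed
  \<comment> \<open>the range condition provides a test vector with \<open>q = qy\<close>\<close>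
  obtain r where "D qy = S r" using ran by blast
  then have "S (- r) + D qy = 0" by (simp add: bounded_clinear_simps[OF S_D_clinear(1)])
  then have r: "cinner (- r) py = cinner qy qy" "norm (- r) \<le> norm qy"
    using pair contr by blast+
  have "(norm qy)\<^sup>2 = Re (cinner (- r) py)" by (simp only: r(1) Re_cinner_self)
  also have "\<dots> \<le> norm qy * norm py"
    using Re_cinner_le[of "- r" py] r(2) by (meson mult_right_mono norm_ge_zero order_trans)
  finally have "norm qy * norm qy \<le> norm qy * norm py" by (simp add: power2_eq_square)
  then have "norm qy \<le> norm py" by (cases "qy = 0") simp_all
  then have "(norm qy)\<^sup>2 \<le> (norm py)\<^sup>2" by (intro power_mono) auto
  then have "0 \<le> Re (cinner y (- v))"
    using Re_cinner_Astar[OF y(1)] unfolding y(2) py_def qy_def by linarith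
  then have "(norm y)\<^sup>2 / h \<le> 0"
    by (simp add: v_def cinner_minus_right cinner_scaleR_right Re_cinner_self)
  then show "y = 0" using h by (simp add: divide_le_0_iff)
qed

end

section \<open>Characterization of the generators\<close>

theorem theorem2p5:
  fixes A\<^sub>0 A :: "'x::complex_hilbert \<rightharpoonup> 'x"
    and B\<^sub>1 B\<^sub>2 :: "'x \<Rightarrow> 'b::complex_hilbert"
    and W\<^sub>B :: "'b \<times> 'b \<Rightarrow> 'k::complex_hilbert"
    and W\<^sub>1 W\<^sub>2 :: "'b \<Rightarrow> 'k"
  assumes "boundary_triplet A\<^sub>0 B\<^sub>1 B\<^sub>2"
    and "bounded_clinear W\<^sub>B"
    and "W\<^sub>1 = (\<lambda>f. W\<^sub>B (f, 0))"
    and "W\<^sub>2 = (\<lambda>e. W\<^sub>B (0, e))"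
    and "A = adjoint_operator A\<^sub>0 |`
               {x \<in> dom (adjoint_operator A\<^sub>0). W\<^sub>1 (B\<^sub>1 x) + W\<^sub>2 (B\<^sub>2 x) = 0}"
    and "range (\<lambda>f. W\<^sub>1 f - W\<^sub>2 f) \<subseteq> range (\<lambda>f. W\<^sub>1 f + W\<^sub>2 f)"
  shows "(generates_contraction_semigroup A \<longleftrightarrow> dissipative A) \<and>
         (dissipative A \<longleftrightarrow>
            inj (\<lambda>f. W\<^sub>1 f + W\<^sub>2 f) \<and>
            nonneg_operator (\<lambda>k. W\<^sub>1 (cadjoint W\<^sub>2 k) + W\<^sub>2 (cadjoint W\<^sub>1 k)))"
proof -
  have "bounded_linear W\<^sub>B" using assms(2) by (simp add: bounded_clinear_def)
  moreover have "bounded_linear (\<lambda>f::'b. (f, 0::'b))" "bounded_linear (\<lambda>e::'b. (0::'b, e))"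
    by (intro bounded_linear_Pair bounded_linear_ident bounded_linear_zero)+
  ultimately have "bounded_linear W\<^sub>1" "bounded_linear W\<^sub>2"
    unfolding assms(3,4) by (auto intro: bounded_linear_compose)
  moreover have "W\<^sub>1 (c *\<^sub>C f) = c *\<^sub>C W\<^sub>1 f" "W\<^sub>2 (c *\<^sub>C f) = c *\<^sub>C W\<^sub>2 f" for c f
    using bounded_clinear_simps(6)[OF assms(2), of c "(f, 0)"]
      bounded_clinear_simps(6)[OF assms(2), of c "(0, f)"]
    by (simp_all add: assms(3,4) scaleC_prod_def)
  ultimately have W: "bounded_clinear W\<^sub>1" "bounded_clinear W\<^sub>2"
    by (simp_all add: bounded_clinear_def)
  interpret bc: boundary_condition A\<^sub>0 B\<^sub>1 B\<^sub>2 W\<^sub>1 W\<^sub>2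
    by unfold_locales (fact assms(1) W)+
  have A: "bc.A = A" by (simp only: bc.A_def assms(5))
  have S: "bc.S = (\<lambda>f. W\<^sub>1 f + W\<^sub>2 f)" and D: "bc.D = (\<lambda>f. W\<^sub>1 f - W\<^sub>2 f)"
    by (simp_all add: fun_eq_iff bc.S_def bc.D_def)
  note clinear = bc.S_D_clinear[unfolded S D]
  have "dissipative A" if "generates_contraction_semigroup A"
    using that dissipative_generator unfolding generates_contraction_semigroup_def by blast
  moreover have "generates_contraction_semigroup A" if "dissipative A"
    using bc.m_dissipative_A[unfolded A S D, OF assms(6) that] by (rule m_dissipative_generates)
  moreover have "dissipative A \<longleftrightarrow> inj (\<lambda>f. W\<^sub>1 f + W\<^sub>2 f) \<and>
      nonneg_operator (\<lambda>k. W\<^sub>1 (cadjoint W\<^sub>2 k) + W\<^sub>2 (cadjoint W\<^sub>1 k))"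
    using bc.dissipative_iff[unfolded A S D] contractive_relation_iff[OF clinear assms(6)]
      nonneg_operator_iff[OF W clinear] by simp
  ultimately show ?thesis by blast
qed

end
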